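(* Let $B=\{b_0,b_1,\dots\}$ be any fixed basis of $\mathbf{V}_\infty$ and let $\phi:N_{\omega^*}\to(F_q^{\omega^*})^{\omega^*}$ be the Borel map $\phi(<)=(\phi_<(b_i))_{i\in\omega^*}$. Let $\sigma$ be the product measure on $(F_q^{\omega^*})^{\omega^*}$, and $\mu$ the unique $\mathrm{Aut}(\mathbf{V}_\infty)$-invariant Borel probability measure on $X_{\mathcal{K}^*}$. Then $\phi$ is injective and almost everywhere surjective (its image has full $\sigma$-measure). Moreover $\sigma=\phi_*\mu$, so that $\phi$ gives a mod zero isomorphism of $(X_{\mathcal{K}^*},\mu)$ and $((F_q^{\omega^*})^{\omega^*},\sigma)$.
   Context: Fix a finite field $F_q$ and a linear ordering of the set $F_q$ in which $0$ is least and $1$ is second least. $\mathbf{V}_\infty$ is the countably infinite dimensional $F_q$-vector space. For a finite dimensional $U$ with ordered basis $b_0,\dots,b_{n-1}$, the induced ordering is: $\sum x_ib_i>\sum y_ib_i$ iff $x_\ell>y_\ell$, where $\ell$ is the least index with $x_\ell\ne y_\ell$. Orderings of this form are natural. $X_{\mathcal{K}^*}$ is the set of linear orderings of $\mathbf{V}_\infty$ whose restriction to every finite dimensional subspace is natural, with the compact metrizable topology generated by the sets $N_{\langle W,<_W\rangle}=\{<\,\in X_{\mathcal{K}^*}:<|_W=<_W\}$ ($W$ finite dimensional, $<_W$ natural). The measure $\mu$ is characterized by $\mu(N_{\langle W,<_W\rangle})=1/|\mathrm{GL}(W)|$. Given $<\,\in X_{\mathcal{K}^*}$ and nonzero $u,v$: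 for $q>2$, $u\ll v$ iff $cu<dv$ for all $c,d\in F_q\setminus\{0\}$, and $u\sim v$ iff neither $u\ll v$ nor $v\ll u$; for $q=2$, $u\sim v$ iff $u+v<\min(u,v)$. $\sim$ is an equivalence relation on nonzero vectors, and $\mathbf{V}_\infty/\!\sim$ (classes of nonzero vectors) is linearly ordered by $A<B$ iff $a<b$ for all $a\in A,b\in B$. $N_{\omega^*}$ is the set of $<\,\in X_{\mathcal{K}^*}$ for which $\mathbf{V}_\infty/\!\sim$ has order type $\omega^*$ (the reverse of $\omega$); it satisfies $\mu(N_{\omega^*})=1$, and for $\phi_*\mu$ one regards $\mu$ as a measure on $N_{\omega^*}$. For $<\,\in N_{\omega^*}$, enumerate $\mathbf{V}_\infty/\!\sim$ as $\alpha_0>\alpha_1>\cdots$ and pick $w_i\in\alpha_i$ minimal in its line (i.e. $w_i\le cw_i$ for all $c\in F_q\setminus\{0\}$). For $v\in\mathbf{V}_\infty$ let $v_i\in F_q$ be the element with $v-v_iw_i<v-dw_i$ for all $d\in F_q$, $d\ne v_i$ (this does not depend on the choice of $w_i$). Define $\phi_<:\mathbf{V}_\infty\to F_q^{\omega^*}$ by $\phi_<(v)=(v_i)_{i\in\omega^*}$. As an index set, $\omega^*$ consists of the indices $0,1,2,\dots$. The product measure $\sigma$ is the product of copies of the uniform probability measure on $F_q$. *)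

theory Defs
  imports "HOL-Probability.Probability"
begin

text \<open>
  Throughout, \<open>smul\<close> is the scalar multiplication of an \<open>F\<^sub>q\<close>-vector space on the type
  \<open>'v\<close>, and \<open>F\<close> is the fixed strict linear ordering of the field. All orderings are strict and
  are represented as sets of pairs: \<open>(x, y) \<in> r\<close> means \<open>x < y\<close>.
\<close>

definition field_ordering :: "('f::{field,finite}) rel \<Rightarrow> bool" where
  "field_ordering F \<longleftrightarrow>
     strict_linear_order_on UNIV F \<and>
     (\<forall>x. x \<noteq> 0 \<longrightarrow> (0, x) \<in> F) \<and>
     (\<forall>x. x \<noteq> 0 \<and> x \<noteq> 1 \<longrightarrow> (1, x) \<in> F)"

definition findim_subspace ::
    "('f::{field,finite} \<Rightarrow> 'v::ab_group_add \<Rightarrow> 'v) \<Rightarrow> 'v set \<Rightarrow> bool" where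
  "findim_subspace smul W \<longleftrightarrow> (\<exists>S. finite S \<and> module.span smul S = W)"

definition lincomb ::
    "('f::{field,finite} \<Rightarrow> 'v::ab_group_add \<Rightarrow> 'v) \<Rightarrow> 'v list \<Rightarrow> (nat \<Rightarrow> 'f) \<Rightarrow> 'v" where
  "lincomb smul bs x = (\<Sum>i<length bs. smul (x i) (bs ! i))"

definition induced_ordering ::
    "('f::{field,finite} \<Rightarrow> 'v::ab_group_add \<Rightarrow> 'v) \<Rightarrow> 'f rel \<Rightarrow> 'v list \<Rightarrow> 'v rel" where
  "induced_ordering smul F bs =
     {(lincomb smul bs y, lincomb smul bs x) | x y.
        \<exists>l<length bs. (\<forall>i<l. x i = y i) \<and> x l \<noteq> y l \<and> (y l, x l) \<in> F}"

definition natural_ordering ::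
    "('f::{field,finite} \<Rightarrow> 'v::ab_group_add \<Rightarrow> 'v) \<Rightarrow> 'f rel \<Rightarrow> 'v set \<Rightarrow> 'v rel \<Rightarrow> bool" where
  "natural_ordering smul F W s \<longleftrightarrow>
     (\<exists>bs. distinct bs \<and> \<not> module.dependent smul (set bs) \<and> module.span smul (set bs) = W \<and>
           s = induced_ordering smul F bs)"

definition X_space ::
    "('f::{field,finite} \<Rightarrow> 'v::ab_group_add \<Rightarrow> 'v) \<Rightarrow> 'f rel \<Rightarrow> 'v rel set" where
  "X_space smul F =
     {r. strict_linear_order_on UNIV r \<and>
         (\<forall>W. findim_subspace smul W \<longrightarrow> natural_ordering smul F W (Restr r W))}"

definition basic_nbhd ::
    "('f::{field,finite} \<Rightarrow> 'v::ab_group_add \<Rightarrow> 'v) \<Rightarrow> 'f rel \<Rightarrow> 'v set \<Rightarrow> 'v rel \<Rightarrow> 'v rel set" where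
  "basic_nbhd smul F W s = {r \<in> X_space smul F. Restr r W = s}"

definition X_topology ::
    "('f::{field,finite} \<Rightarrow> 'v::ab_group_add \<Rightarrow> 'v) \<Rightarrow> 'f rel \<Rightarrow> 'v rel topology" where
  "X_topology smul F = topology_generated_by
     {basic_nbhd smul F W s | W s. findim_subspace smul W \<and> natural_ordering smul F W s}"

definition X_borel ::
    "('f::{field,finite} \<Rightarrow> 'v::ab_group_add \<Rightarrow> 'v) \<Rightarrow> 'f rel \<Rightarrow> 'v rel measure" where
  "X_borel smul F = sigma (X_space smul F) {U. openin (X_topology smul F) U}"

definition Aut ::
    "('f::{field,finite} \<Rightarrow> 'v::ab_group_add \<Rightarrow> 'v) \<Rightarrow> ('v \<Rightarrow> 'v) set" where
  "Aut smul = {g. Vector_Spaces.linear smul smul g \<and> bij g}"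

text \<open>The action on orderings: \<open>x (g \<cdot> <) y\<close> iff \<open>g\<inverse> x < g\<inverse> y\<close>.\<close>

definition act :: "('v \<Rightarrow> 'v) \<Rightarrow> 'v rel \<Rightarrow> 'v rel" where
  "act g r = map_prod g g ` r"

definition invariant_borel_prob ::
    "('f::{field,finite} \<Rightarrow> 'v::ab_group_add \<Rightarrow> 'v) \<Rightarrow> 'f rel \<Rightarrow> 'v rel measure \<Rightarrow> bool" where
  "invariant_borel_prob smul F \<mu> \<longleftrightarrow>
     prob_space \<mu> \<and> sets \<mu> = sets (X_borel smul F) \<and>
     (\<forall>g\<in>Aut smul. \<forall>A\<in>sets \<mu>. emeasure \<mu> (act g ` A) = emeasure \<mu> A)"

definition much_less ::
    "('f::{field,finite} \<Rightarrow> 'v::ab_group_add \<Rightarrow> 'v) \<Rightarrow> 'v rel \<Rightarrow> 'v \<Rightarrow> 'v \<Rightarrow> bool" where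
  "much_less smul r u v \<longleftrightarrow> (\<forall>c d. c \<noteq> 0 \<and> d \<noteq> 0 \<longrightarrow> (smul c u, smul d v) \<in> r)"

definition sim_rel ::
    "('f::{field,finite} \<Rightarrow> 'v::ab_group_add \<Rightarrow> 'v) \<Rightarrow> 'v rel \<Rightarrow> 'v rel" where
  "sim_rel smul r =
     {(u, v). u \<noteq> 0 \<and> v \<noteq> 0 \<and>
        (if CARD('f) = 2 then (u + v, if (u, v) \<in> r then u else v) \<in> r
         else \<not> much_less smul r u v \<and> \<not> much_less smul r v u)}"

definition sim_classes ::
    "('f::{field,finite} \<Rightarrow> 'v::ab_group_add \<Rightarrow> 'v) \<Rightarrow> 'v rel \<Rightarrow> 'v set set" where
  "sim_classes smul r = (UNIV - {0}) // sim_rel smul r"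

definition class_less :: "'v rel \<Rightarrow> 'v set \<Rightarrow> 'v set \<Rightarrow> bool" where
  "class_less r A B \<longleftrightarrow> (\<forall>a\<in>A. \<forall>b\<in>B. (a, b) \<in> r)"

text \<open>\<open>\<alpha> 0 > \<alpha> 1 > \<dots>\<close> is a strictly decreasing enumeration of all the classes.\<close>

definition decreasing_enum ::
    "('f::{field,finite} \<Rightarrow> 'v::ab_group_add \<Rightarrow> 'v) \<Rightarrow> 'v rel \<Rightarrow> (nat \<Rightarrow> 'v set) \<Rightarrow> bool" where
  "decreasing_enum smul r \<alpha> \<longleftrightarrow>
     bij_betw \<alpha> UNIV (sim_classes smul r) \<and> (\<forall>i j. i < j \<longrightarrow> class_less r (\<alpha> j) (\<alpha> i))"

definition N_omega ::
    "('f::{field,finite} \<Rightarrow> 'v::ab_group_add \<Rightarrow> 'v) \<Rightarrow> 'f rel \<Rightarrow> 'v rel set" where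
  "N_omega smul F = {r \<in> X_space smul F. \<exists>\<alpha>. decreasing_enum smul r \<alpha>}"

definition sim_class ::
    "('f::{field,finite} \<Rightarrow> 'v::ab_group_add \<Rightarrow> 'v) \<Rightarrow> 'v rel \<Rightarrow> nat \<Rightarrow> 'v set" where
  "sim_class smul r = (THE \<alpha>. decreasing_enum smul r \<alpha>)"

definition class_rep ::
    "('f::{field,finite} \<Rightarrow> 'v::ab_group_add \<Rightarrow> 'v) \<Rightarrow> 'v rel \<Rightarrow> nat \<Rightarrow> 'v" where
  "class_rep smul r i =
     (SOME w. w \<in> sim_class smul r i \<and> (\<forall>c. c \<noteq> 0 \<longrightarrow> w = smul c w \<or> (w, smul c w) \<in> r))"

definition phi_ord ::
    "('f::{field,finite} \<Rightarrow> 'v::ab_group_add \<Rightarrow> 'v) \<Rightarrow> 'v rel \<Rightarrow> 'v \<Rightarrow> nat \<Rightarrow> 'f" where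
  "phi_ord smul r v i =
     (THE a. \<forall>d. d \<noteq> a \<longrightarrow>
        (v - smul a (class_rep smul r i), v - smul d (class_rep smul r i)) \<in> r)"

definition phi ::
    "('f::{field,finite} \<Rightarrow> 'v::ab_group_add \<Rightarrow> 'v) \<Rightarrow> (nat \<Rightarrow> 'v) \<Rightarrow> 'v rel \<Rightarrow> nat \<Rightarrow> nat \<Rightarrow> 'f" where
  "phi smul b r = (\<lambda>i. phi_ord smul r (b i))"

definition sigma_prod :: "(nat \<Rightarrow> nat \<Rightarrow> 'f::{field,finite}) measure" where
  "sigma_prod = PiM UNIV (\<lambda>_. PiM UNIV (\<lambda>_. uniform_count_measure UNIV))"

text \<open>
  A map \<open>f\<close>, meaningful only on \<open>D\<close>, gives a mod zero isomorphism of \<open>M\<close> and \<open>N\<close> if it restricts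
  to an isomorphism of measure spaces between sets of full measure.
\<close>

definition mod_zero_isomorphism ::
    "'a measure \<Rightarrow> 'b measure \<Rightarrow> 'a set \<Rightarrow> ('a \<Rightarrow> 'b) \<Rightarrow> bool" where
  "mod_zero_isomorphism M N D f \<longleftrightarrow>
     (\<exists>A B. A \<in> sets M \<and> A \<subseteq> D \<and> space M - A \<in> null_sets M \<and>
            B \<in> sets N \<and> space N - B \<in> null_sets N \<and>
            bij_betw f A B \<and>
            f \<in> restrict_space M A \<rightarrow>\<^sub>M restrict_space N B \<and>
            the_inv_into A f \<in> restrict_space N B \<rightarrow>\<^sub>M restrict_space M A \<and>
            distr (restrict_space M A) (restrict_space N B) f = restrict_space N B)"

end

theory Submission imports Defs begin

text \<open>
  An ordering in \<open>N_omega\<close> is a lexicographic ordering in disguise. On a finite-dimensional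
  subspace a natural ordering compares coordinates, so two vectors are compared at the first
  coordinate where they differ; \<open>\<sim>\<close> says that two vectors have the same leading index, and the
  representative \<open>w\<^sub>i\<close> is a vector with leading coefficient 1. Hence the coefficient \<open>v\<^sub>i\<close> is the
  coordinate of \<open>v\<close> at the leading index of \<open>w\<^sub>i\<close>, so it is linear in \<open>v\<close>, and the sequence of linear
  forms \<open>v \<mapsto> v\<^sub>i\<close> represents the whole ordering lexicographically (\<open>lex_rep_phi_ord\<close>).

  A matrix \<open>M\<close> prescribes the values of such forms on the basis \<open>b\<close>, and therefore linear forms
  \<open>extend M i\<close> on the whole space. Pulling back the lexicographic ordering along them gives a member
  of \<open>N_omega\<close> whose coefficients at \<open>b\<close> are the entries of \<open>M\<close> exactly when the forms separate
  points and every index is a leading index; such matrices are called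
  \<open>regular\<close>. On them this pullback, \<open>lex_order\<close>, is inverse to \<open>phi\<close> (\<open>bij_phi\<close>), which gives
  injectivity and identifies the image. Almost every matrix is
  regular (\<open>emeasure_regular\<close>): for \<open>v \<noteq> 0\<close> the sequence of values at \<open>v\<close> is spread uniformly, and
  among infinitely many independent rows one has any prescribed initial segment.

  The measures are compared by symmetry. An automorphism \<open>g\<close> acts on matrices by precomposing the forms
  with \<open>g\<close>. This is an additive bijection, so it carries the uniform measure to a
  translation-invariant one, and translation invariance characterises the uniform measure
  (\<open>translation_invariant_unique\<close>). So the image of the uniform measure under \<open>lex_order\<close> is an
  invariant measure on orderings. On the other hand \<open>Aut\<close> permutes transitively the orderings of
  each \<open>span {b 0, \<dots>, b (n - 1)}\<close>, so an invariant probability measure gives the same mass to each of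
  finitely many cells, and is unique (\<open>invariant_borel_prob_unique\<close>). Both uniqueness statements are
  instances of \<open>prob_eqI_nested_partitions\<close>.
\<close>

section \<open>Lexicographic representations of orderings\<close>

locale ordered_scalars = vector_space smul
  for smul :: "'f::{field,finite} \<Rightarrow> 'v::ab_group_add \<Rightarrow> 'v" +
  fixes F :: "'f rel"
  assumes F: "field_ordering F"
begin

lemma F_irrefl: "(x, x) \<notin> F"
  using F by (auto simp: field_ordering_def strict_linear_order_on_def irrefl_def)

lemma F_trans: "(x, y) \<in> F \<Longrightarrow> (y, z) \<in> F \<Longrightarrow> (x, z) \<in> F"
  using F by (auto simp: field_ordering_def strict_linear_order_on_def dest: transD)

lemma F_total: "x \<noteq> y \<Longrightarrow> (x, y) \<in> F \<or> (y, x) \<in> F"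
  using F by (auto simp: field_ordering_def strict_linear_order_on_def total_on_def)

lemma F_asym: "(x, y) \<in> F \<Longrightarrow> (y, x) \<notin> F"
  using F_irrefl F_trans by blast

lemma F_zero: "(0, x) \<in> F \<longleftrightarrow> x \<noteq> 0"
  using F F_irrefl by (auto simp: field_ordering_def)

lemma F_one: "(1, x) \<in> F \<longleftrightarrow> x \<noteq> 0 \<and> x \<noteq> 1"
  using F F_irrefl F_asym F_zero by (metis field_ordering_def)

definition linear_form :: "('v \<Rightarrow> 'f) \<Rightarrow> bool" where
  "linear_form f \<longleftrightarrow> (\<forall>u v. f (u + v) = f u + f v) \<and> (\<forall>c v. f (smul c v) = c * f v)"

lemma linear_form_simps:
  assumes "linear_form f"
  shows "f (u + v) = f u + f v" "f (smul c v) = c * f v" "f 0 = 0" "f (- v) = - f v" "f (u - v) = f u - f v"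
proof -
  show a: "f (u + v) = f u + f v" for u v using assms by (auto simp: linear_form_def)
  show s: "f (smul c v) = c * f v" for c v using assms by (auto simp: linear_form_def)
  show z: "f 0 = 0" using s[of 0 0] by simp
  show m: "f (- v) = - f v" for v using a[of v "- v"] z by (simp add: eq_neg_iff_add_eq_0 add.commute)
  show "f (u - v) = f u - f v" using a[of u "- v"] m[of v] by simp
qed

lemma linear_form_sum:
  assumes "linear_form f"
  shows "f (sum g A) = (\<Sum>a\<in>A. f (g a))"
  by (induction A rule: infinite_finite_induct) (simp_all add: linear_form_simps[OF assms])

definition lex_less :: "(nat \<Rightarrow> 'v \<Rightarrow> 'f) \<Rightarrow> 'v \<Rightarrow> 'v \<Rightarrow> bool" where
  "lex_less x u v \<longleftrightarrow> (\<exists>l. (\<forall>i<l. x i u = x i v) \<and> (x l u, x l v) \<in> F)"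

text \<open>
  Both the natural orderings of finite-dimensional subspaces (with coordinates padded by zero) and
  the orderings in \<open>N_omega\<close> fit this description. The forms are defined and linear on the whole
  space, so that linear algebra needs no membership conditions; only the comparison is restricted to \<open>W\<close>.
\<close>

definition lex_rep :: "'v rel \<Rightarrow> 'v set \<Rightarrow> (nat \<Rightarrow> 'v \<Rightarrow> 'f) \<Rightarrow> bool" where
  "lex_rep r W x \<longleftrightarrow> subspace W \<and> (\<forall>i. linear_form (x i)) \<and>
     (\<forall>v\<in>W. v \<noteq> 0 \<longrightarrow> (\<exists>i. x i v \<noteq> 0)) \<and>
     (\<forall>u\<in>W. \<forall>v\<in>W. (u, v) \<in> r \<longleftrightarrow> lex_less x u v)"

definition lead :: "(nat \<Rightarrow> 'v \<Rightarrow> 'f) \<Rightarrow> 'v \<Rightarrow> nat" where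
  "lead x v = (LEAST i. x i v \<noteq> 0)"

lemma lead_eqI: "(\<And>i. i < l \<Longrightarrow> x i v = 0) \<Longrightarrow> x l v \<noteq> 0 \<Longrightarrow> lead x v = l"
  unfolding lead_def by (rule Least_equality) (auto simp: not_less[symmetric])

lemma before_lead: "i < lead x v \<Longrightarrow> x i v = 0"
  unfolding lead_def using not_less_Least by blast

context
  fixes r W x
  assumes rep: "lex_rep r W x"
begin

lemma subspace_of_rep: "subspace W" and linear_form_of_rep: "linear_form (x i)" 
  and less_iff_lex: "u \<in> W \<Longrightarrow> v \<in> W \<Longrightarrow> (u, v) \<in> r \<longleftrightarrow> lex_less x u v"
  using rep by (auto simp: lex_rep_def)

lemmas lex_rep_linear = linear_form_simps[OF linear_form_of_rep]

lemma at_lead: "v \<in> W \<Longrightarrow> v \<noteq> 0 \<Longrightarrow> x (lead x v) v \<noteq> 0"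
  using rep unfolding lead_def by (metis (mono_tags, lifting) LeastI lex_rep_def)

lemma less_iff_lead:
  assumes "u \<in> W" "v \<in> W" "u \<noteq> v"
  shows "(u, v) \<in> r \<longleftrightarrow> (x (lead x (v - u)) u, x (lead x (v - u)) v) \<in> F"
proof -
  define l where "l = lead x (v - u)"
  have "v - u \<in> W" using assms subspace_of_rep by (simp add: subspace_diff)
  then have l: "x l v \<noteq> x l u" using at_lead[of "v - u"] assms by (simp add: lex_rep_linear l_def)
  have b: "x i u = x i v" if "i < l" for i using before_lead[of i x "v - u"] that by (simp add: lex_rep_linear l_def)
  have "(\<exists>k. (\<forall>i<k. x i u = x i v) \<and> (x k u, x k v) \<in> F) \<longleftrightarrow> (x l u, x l v) \<in> F"
  proof
    assume "\<exists>k. (\<forall>i<k. x i u = x i v) \<and> (x k u, x k v) \<in> F"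
    then obtain k where k: "\<forall>i<k. x i u = x i v" "(x k u, x k v) \<in> F" by blast
    have "k = l" using k l b F_irrefl by (metis linorder_neqE_nat)
    then show "(x l u, x l v) \<in> F" using k by simp
  qed (use b in blast)
  then show ?thesis using less_iff_lex assms by (simp add: l_def lex_less_def)
qed

lemma lead_scale: "c \<noteq> 0 \<Longrightarrow> lead x (smul c v) = lead x v"
  by (simp add: lead_def lex_rep_linear)

lemma lead_minus: "lead x (- v) = lead x v"
  by (simp add: lead_def lex_rep_linear)

lemma lead_diff_less:
  assumes "u \<in> W" "u \<noteq> 0" "lead x u < lead x v"
  shows "lead x (u - v) = lead x u" "lead x (v - u) = lead x u" "lead x (u + v) = lead x u"
  using assms at_lead[of u] before_lead[of _ x u] before_lead[of _ x v]
  by (auto intro!: lead_eqI simp: lex_rep_linear)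

lemma less_iff_lead_less:
  assumes "u \<in> W" "v \<in> W" "u \<noteq> 0" "v \<noteq> 0" "lead x u \<noteq> lead x v"
  shows "(u, v) \<in> r \<longleftrightarrow> lead x v < lead x u"
proof -
  have "u \<noteq> v" using assms by auto
  show ?thesis
  proof (cases "lead x v < lead x u")
    case True
    then show ?thesis using less_iff_lead[OF assms(1,2) \<open>u \<noteq> v\<close>] lead_diff_less(1)[OF _ _ True] assms
        before_lead[OF True] at_lead[of v] by (simp add: F_zero)
  next
    case False
    then have *: "lead x u < lead x v" using assms by auto
    then show ?thesis using less_iff_lead[OF assms(1,2) \<open>u \<noteq> v\<close>] lead_diff_less(2)[OF _ _ *] assms
        before_lead[OF *] at_lead[of u] F_asym F_zero by auto
  qed
qed

text \<open>
  If the leads differ, the larger vector stays larger after scaling, and the sum of the two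
  vectors exceeds the smaller one, because both are compared at the lead of the larger vector, where
  the smaller one vanishes.
  If the leads agree and there are only two scalars, both leading coefficients are 1 and cancel in the
  sum. With a scalar \<open>z \<noteq> 0, 1\<close> at hand, either vector can be scaled to have leading coefficient \<open>z\<close> and the
  other one to have leading coefficient 1, so neither is much less than the other.
\<close>

lemma sim_iff_lead:
  assumes "u \<in> W" "v \<in> W" "u \<noteq> 0" "v \<noteq> 0"
  shows "(u, v) \<in> sim_rel smul r \<longleftrightarrow> lead x u = lead x v"
proof (cases "CARD('f) = 2")
  case True
  have UN: "c = 0 \<or> c = 1" for c :: 'f
  proof -
    have "card {0, 1, c} \<le> 2" using True by (metis card_mono finite subset_UNIV)
    then show ?thesis by (auto simp: card_insert_if split: if_splits)
  qed
  \<comment> \<open>Here w stands for the smaller of the two vectors.\<close>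
  have key: "(u + v, w) \<in> r \<longleftrightarrow> lead x u = lead x v"
    if w: "w = u \<and> lead x v \<le> lead x u \<or> w = v \<and> lead x u \<le> lead x v" for w
  proof (cases "lead x u = lead x v")
    case eq: True
    define l where "l = lead x u"
    have l: "x l u = 1" "x l v = 1" using at_lead[of u] at_lead[of v] assms eq UN by (auto simp: l_def)
    have "(1::'f) + 1 \<noteq> 1" by (metis add_cancel_right_right zero_neq_one)
    then have "x l (u + v) = 0" using l UN[of "1 + 1"] by (simp add: lex_rep_linear del: one_add_one)
    moreover have "x i (u + v) = 0" "x i u = 0" "x i v = 0" if "i < l" for i 
      using that before_lead[of i x] eq by (auto simp: lex_rep_linear l_def)
    moreover have "w = u \<or> w = v" using w by auto
    ultimately have "(u + v, w) \<in> r"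
      using l assms subspace_of_rep F_zero[of 1]
      by (subst less_iff_lex) (auto simp: subspace_add lex_less_def intro!: exI[of _ l])
    then show ?thesis using eq by simp
  next
    case neq: False
    have main: "(a + c, a) \<notin> r" if "a \<in> W" "c \<in> W" "c \<noteq> 0" "lead x c < lead x a" for a c
    proof -
      have "a \<noteq> a + c" using that by simp
      moreover have "lead x (a - (a + c)) = lead x c" using lead_minus[of c] by simp
      ultimately have "(a + c, a) \<in> r \<longleftrightarrow> (x (lead x c) (a + c), x (lead x c) a) \<in> F"
        using less_iff_lead[of "a + c" a] that subspace_of_rep by (simp add: subspace_add)
      then show ?thesis using before_lead[OF that(4)] at_lead[OF that(2,3)] F_asym F_zero
        by (auto simp: lex_rep_linear)
    qed
    show ?thesis using w neq main[of u v] main[of v u] assms by (auto simp: add.commute)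
  qed
  have *: "lead x v \<le> lead x u" if "(u, v) \<in> r" using less_iff_lead_less[OF assms] that by force
  have **: "lead x u \<le> lead x v" if "(u, v) \<notin> r" using less_iff_lead_less[OF assms] that by force
  have "(u + v, if (u, v) \<in> r then u else v) \<in> r \<longleftrightarrow> lead x u = lead x v"
    by (rule key) (use * ** in auto)
  then show ?thesis using True assms by (simp add: sim_rel_def)
next
  case False
  have "\<exists>z::'f. z \<noteq> 0 \<and> z \<noteq> 1"
  proof (rule ccontr)
    assume "\<not> ?thesis"
    then have "(UNIV :: 'f set) = {0, 1}" by auto
    then have "card (UNIV :: 'f set) = card {0 :: 'f, 1}" by (rule arg_cong)
    then show False using False by simp
  qed
  then obtain z :: 'f where z: "z \<noteq> 0" "z \<noteq> 1" by blast
  have ml: "much_less smul r a c \<longleftrightarrow> lead x c < lead x a" if "a \<in> W" "c \<in> W" "a \<noteq> 0" "c \<noteq> 0" for a c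
  proof
    assume "lead x c < lead x a"
    then show "much_less smul r a c" using that subspace_of_rep
      by (auto simp: much_less_def less_iff_lead_less subspace_scale lead_scale)
  next
    assume m: "much_less smul r a c"
    show "lead x c < lead x a"
    proof (cases "lead x c = lead x a")
      case False
      then show ?thesis using less_iff_lead_less[of a c] that m
        by (metis much_less_def scale_one zero_neq_one)
    next
      case True
      define l where "l = lead x a"
      define p where "p = z / x l a" 
      define q where "q = 1 / x l c"
      have nz: "x l a \<noteq> 0" "x l c \<noteq> 0" using at_lead[of a] at_lead[of c] that True by (auto simp: l_def)
      have pq: "p \<noteq> 0" "q \<noteq> 0" using nz z by (auto simp: p_def q_def)
      have xp: "x l (smul p a) = z" "x l (smul q c) = 1" using nz by (auto simp: p_def q_def lex_rep_linear)
      \<comment> \<open>The coordinates at l are 1 and z, which contradicts much_less.\<close>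
      have "(smul q c, smul p a) \<in> r"
        using that subspace_of_rep xp z before_lead[of _ x] True
        by (subst less_iff_lex) (auto simp: subspace_scale lex_less_def lex_rep_linear F_one l_def intro!: exI[of _ l])
      moreover have "(smul p a, smul q c) \<in> r" using m pq by (auto simp: much_less_def)
      moreover have "smul p a \<in> W" "smul q c \<in> W" "smul p a \<noteq> smul q c"
        using that subspace_of_rep xp z by (auto simp: subspace_scale)
      moreover have "lead x (smul q c - smul p a) = lead x (smul p a - smul q c)" 
        using lead_minus by (metis minus_diff_eq)
      ultimately show ?thesis using less_iff_lead[of "smul p a" "smul q c"] less_iff_lead[of "smul q c" "smul p a"]
        F_asym by auto
    qed
  qed
  show ?thesis using False assms ml by (auto simp: sim_rel_def)
qed

text \<open>
  The scalar 1 is the least nonzero one, so the least vector of a line is the one whose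
  leading coefficient is 1.
\<close>

lemma normalised_iff:
  assumes "w \<in> W" "w \<noteq> 0"
  shows "(\<forall>c. c \<noteq> 0 \<longrightarrow> w = smul c w \<or> (w, smul c w) \<in> r) \<longleftrightarrow> x (lead x w) w = 1"
proof -
  have *: "w \<noteq> smul c w \<and> ((w, smul c w) \<in> r \<longleftrightarrow> (x (lead x w) w, c * x (lead x w) w) \<in> F)" 
    if "c \<noteq> 1" for c
  proof -
    have d: "smul c w - w = smul (c - 1) w" by (simp add: scale_left_diff_distrib)
    then have ne: "w \<noteq> smul c w" using that assms by (metis eq_iff_diff_eq_0 scale_eq_0_iff)
    have "lead x (smul c w - w) = lead x w" unfolding d using that by (intro lead_scale) auto
    then show ?thesis using ne less_iff_lead[OF assms(1) _ ne] subspace_of_rep assms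
      by (simp add: subspace_scale lex_rep_linear)
  qed
  have nz: "x (lead x w) w \<noteq> 0" using at_lead assms by auto
  show ?thesis
  proof
    assume a: "\<forall>c. c \<noteq> 0 \<longrightarrow> w = smul c w \<or> (w, smul c w) \<in> r"
    show "x (lead x w) w = 1"
    proof (rule ccontr)
      assume n: "x (lead x w) w \<noteq> 1"
      define c where "c = 1 / x (lead x w) w"
      have "c \<noteq> 0" "c \<noteq> 1" using nz n by (auto simp: c_def)
      then have "(x (lead x w) w, c * x (lead x w) w) \<in> F" using a * by blast
      then have "(x (lead x w) w, 1) \<in> F" using nz by (simp add: c_def)
      then show False using F_one n nz F_asym by blast
    qed
  next
    assume e: "x (lead x w) w = 1"
    show "\<forall>c. c \<noteq> 0 \<longrightarrow> w = smul c w \<or> (w, smul c w) \<in> r"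
    proof (intro allI impI)
      fix c :: 'f assume "c \<noteq> 0"
      then show "w = smul c w \<or> (w, smul c w) \<in> r" 
        by (cases "c = 1") (use * e F_one[of c] in auto)
    qed
  qed
qed

text \<open>
  The vectors \<open>v - d w\<close> differ from each other first at the lead of \<open>w\<close>, where their
  coordinate is \<open>x v - d\<close>; the scalar 0 is the least one.
\<close>

lemma coefficient_iff:
  assumes "w \<in> W" "w \<noteq> 0" "x (lead x w) w = 1" "v \<in> W"
  shows "(\<forall>d. d \<noteq> a \<longrightarrow> (v - smul a w, v - smul d w) \<in> r) \<longleftrightarrow> a = x (lead x w) v"
proof -
  define l where "l = lead x w"
  have *: "(v - smul a w, v - smul d w) \<in> r \<longleftrightarrow> (x l v - a, x l v - d) \<in> F" if "d \<noteq> a" for a d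
  proof -
    have d: "(v - smul d w) - (v - smul a w) = smul (a - d) w" by (simp add: scale_left_diff_distrib)
    then have ne: "v - smul a w \<noteq> v - smul d w" using that assms(2) by (metis eq_iff_diff_eq_0 scale_eq_0_iff)
    have "lead x ((v - smul d w) - (v - smul a w)) = l" unfolding d l_def using that by (intro lead_scale) auto
    then show ?thesis using less_iff_lead[OF _ _ ne] subspace_of_rep assms
      by (simp add: subspace_scale subspace_diff lex_rep_linear l_def)
  qed
  show ?thesis
  proof
    assume a: "\<forall>d. d \<noteq> a \<longrightarrow> (v - smul a w, v - smul d w) \<in> r"
    show "a = x (lead x w) v"
    proof (rule ccontr)
      assume "a \<noteq> x (lead x w) v"
      then have "(x l v - a, 0) \<in> F" using a *[of "x l v" a] by (auto simp: l_def)
      then show False using F_zero F_irrefl F_asym by metis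
    qed
  next
    assume "a = x (lead x w) v"
    then show "\<forall>d. d \<noteq> a \<longrightarrow> (v - smul a w, v - smul d w) \<in> r" using * by (auto simp: l_def F_zero)
  qed
qed

end

lemma finite_span: 
  assumes "finite S" shows "finite (span S)"
proof -
  have "span S \<subseteq> (\<lambda>u. \<Sum>v\<in>S. smul (u v) v) ` (S \<rightarrow>\<^sub>E UNIV)"
  proof
    fix y assume "y \<in> span S"
    then have "y \<in> range (\<lambda>u. \<Sum>v\<in>S. smul (u v) v)" by (simp only: span_finite[OF assms])
    then obtain u where "y = (\<Sum>v\<in>S. smul (u v) v)" by (elim rangeE)
    then have "y = (\<Sum>v\<in>S. smul (restrict u S v) v)" by simp
    then show "y \<in> (\<lambda>u. \<Sum>v\<in>S. smul (u v) v) ` (S \<rightarrow>\<^sub>E UNIV)"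
      by (intro rev_image_eqI[of "restrict u S"]) simp_all
  qed
  moreover have "finite (S \<rightarrow>\<^sub>E (UNIV :: 'f set))" using assms by (intro finite_PiE) auto
  ultimately show ?thesis by (meson finite_imageI finite_subset)
qed

lemma findim_subspace_iff: "findim_subspace smul W \<longleftrightarrow> subspace W \<and> finite W"
proof
  assume "findim_subspace smul W"
  then show "subspace W \<and> finite W" unfolding findim_subspace_def using finite_span subspace_span by blast
next
  assume "subspace W \<and> finite W"
  then show "findim_subspace smul W" 
    unfolding findim_subspace_def by (intro exI[of _ W] conjI) (simp_all only: span_eq_iff)
qed

text \<open>Coordinates with respect to an independent list, extended linearly to the whole space.\<close>

definition coord :: "'v list \<Rightarrow> nat \<Rightarrow> 'v \<Rightarrow> 'f" where
  "coord bs i v = (if i < length bs then representation (extend_basis (set bs)) v (bs ! i) else 0)"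

context
  fixes bs :: "'v list"
  assumes bs: "distinct bs" "independent (set bs)"
begin

lemma linear_form_coord: "linear_form (coord bs i)"
proof -
  have "independent (extend_basis (set bs))" "u \<in> span (extend_basis (set bs))" for u
    using independent_extend_basis[OF bs(2)] span_extend_basis[OF bs(2)] by auto
  note R = representation_add[OF this(1,2,2)] representation_scale[OF this(1,2)]
  show ?thesis unfolding linear_form_def coord_def by (simp add: R)
qed

lemma coord_basis: 
  assumes "j < length bs" shows "coord bs i (bs ! j) = (if i = j then 1 else 0)"
proof -
  have "bs ! j \<in> extend_basis (set bs)" using extend_basis_superset[OF bs(2)] assms by auto
  then show ?thesis unfolding coord_def
    using bs(1) assms
    by (auto simp: representation_basis[OF independent_extend_basis[OF bs(2)]] nth_eq_iff_index_eq)
qed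

lemma coord_lincomb: "i < length bs \<Longrightarrow> coord bs i (lincomb smul bs y) = y i"
  unfolding lincomb_def
  by (simp add: linear_form_sum[OF linear_form_coord] linear_form_simps[OF linear_form_coord] coord_basis
     mult_delta_right)

lemma lincomb_coord:
  assumes "v \<in> span (set bs)"
  shows "lincomb smul bs (\<lambda>i. coord bs i v) = v"
proof -
  have "v \<in> range (\<lambda>u. \<Sum>a\<in>set bs. smul (u a) a)"
    using assms by (simp only: span_finite[OF finite_set])
  then obtain u where u: "v = (\<Sum>a\<in>set bs. smul (u a) a)" by (elim rangeE)
  have "(\<Sum>i<length bs. smul (u (bs ! i)) (bs ! i)) = (\<Sum>a\<in>set bs. smul (u a) a)"
    by (rule sum.reindex_bij_betw[OF bij_betw_nth[OF bs(1) refl refl]])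
  with u have *: "v = lincomb smul bs (\<lambda>i. u (bs ! i))" by (simp add: lincomb_def)
  have "coord bs i v = u (bs ! i)" if "i < length bs" for i
    unfolding * using that by (rule coord_lincomb)
  then show ?thesis unfolding * by (simp add: lincomb_def)
qed

lemma lincomb_in_span: "lincomb smul bs y \<in> span (set bs)"
  unfolding lincomb_def by (intro span_sum span_scale span_base) auto

lemma induced_ordering_iff:
  "(u, v) \<in> induced_ordering smul F bs \<longleftrightarrow> 
     u \<in> span (set bs) \<and> v \<in> span (set bs) \<and> lex_less (coord bs) u v"
proof
  assume "(u, v) \<in> induced_ordering smul F bs"
  then obtain y z l where *: "u = lincomb smul bs y" "v = lincomb smul bs z" "l < length bs"
    "\<forall>i<l. z i = y i" "(y l, z l) \<in> F" by (auto simp: induced_ordering_def)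
  then show "u \<in> span (set bs) \<and> v \<in> span (set bs) \<and> lex_less (coord bs) u v"
    by (auto simp: lincomb_in_span lex_less_def coord_lincomb intro!: exI[of _ l])
next
  assume a: "u \<in> span (set bs) \<and> v \<in> span (set bs) \<and> lex_less (coord bs) u v"
  then obtain l where l: "\<forall>i<l. coord bs i u = coord bs i v" "(coord bs l u, coord bs l v) \<in> F" 
    by (auto simp: lex_less_def)
  have "l < length bs" using l(2) F_irrefl by (auto simp: coord_def split: if_splits)
  then show "(u, v) \<in> induced_ordering smul F bs"
    unfolding induced_ordering_def mem_Collect_eq using l a F_irrefl
    by (intro exI[of _ "\<lambda>i. coord bs i v"] exI[of _ "\<lambda>i. coord bs i u"] conjI exI[of _ l])
       (auto simp: lincomb_coord) 
qed

lemma lex_rep_coord: "lex_rep (induced_ordering smul F bs) (span (set bs)) (coord bs)"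
proof -
  have "\<exists>i. coord bs i v \<noteq> 0" if "v \<in> span (set bs)" "v \<noteq> 0" for v
  proof (rule ccontr)
    assume "\<not> ?thesis"
    then have "lincomb smul bs (\<lambda>i. coord bs i v) = 0" by (simp add: lincomb_def)
    then show False using lincomb_coord[OF that(1)] that(2) by simp
  qed
  then show ?thesis
    unfolding lex_rep_def by (auto simp: subspace_span linear_form_coord induced_ordering_iff)
qed

end

lemma lex_rep_Restr: "lex_rep (Restr r W) W x \<longleftrightarrow> lex_rep r W x"
  by (auto simp: lex_rep_def)

text \<open>
  The basis that induces a natural ordering supplies the forms.
\<close>

lemma lex_rep_exists:
  assumes "r \<in> X_space smul F" "finite S"
  obtains x where "lex_rep r (span S) x"
proof -
  have "natural_ordering smul F (span S) (Restr r (span S))"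
    using assms by (auto simp: X_space_def findim_subspace_def)
  then obtain bs where bs: "distinct bs" "independent (set bs)" "span (set bs) = span S"
      "Restr r (span S) = induced_ordering smul F bs"
    unfolding natural_ordering_def by blast
  have "lex_rep (Restr r (span S)) (span S) (coord bs)" using lex_rep_coord[OF bs(1,2)] bs(3,4) by simp
  then show thesis using that lex_rep_Restr by blast
qed

lemma lex_rep_strict_linear:
  assumes "lex_rep r UNIV x" 
  shows "strict_linear_order_on UNIV r"
proof -
  note less = less_iff_lex[OF assms UNIV_I UNIV_I]
  have tot: "(u, v) \<in> r \<or> (v, u) \<in> r" if "u \<noteq> v" for u v
  proof -
    have "x (lead x (v - u)) (v - u) \<noteq> 0" using at_lead[OF assms] that by auto
    then have n: "x (lead x (v - u)) u \<noteq> x (lead x (v - u)) v" by (simp add: lex_rep_linear[OF assms])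
    have "lead x (u - v) = lead x (v - u)" using lead_minus[OF assms] by (metis minus_diff_eq)
    then show ?thesis using less_iff_lead[OF assms UNIV_I UNIV_I] that F_total[OF n] by metis
  qed
  have irr: "(u, u) \<notin> r" for u by (simp add: less lex_less_def F_irrefl)
  have tr: "(u, w) \<in> r" if uv: "(u, v) \<in> r" and vw: "(v, w) \<in> r" for u v w
  proof -
    obtain k where k: "\<forall>i<k. x i u = x i v" "(x k u, x k v) \<in> F" using uv by (auto simp: less lex_less_def)
    obtain l where l: "\<forall>i<l. x i v = x i w" "(x l v, x l w) \<in> F" using vw by (auto simp: less lex_less_def)
    have "(x (min k l) u, x (min k l) w) \<in> F"
      using k l F_trans by (cases k l rule: linorder_cases) (auto simp: min_def)
    moreover have "\<forall>i<min k l. x i u = x i w" using k l by simp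
    ultimately show ?thesis unfolding less lex_less_def by blast
  qed
  show ?thesis unfolding strict_linear_order_on_def
    using tot irr tr by (auto simp: trans_def irrefl_def total_on_def)
qed

lemma lex_rep_subset: "lex_rep r W x \<Longrightarrow> subspace V \<Longrightarrow> V \<subseteq> W \<Longrightarrow> lex_rep r V x"
  unfolding lex_rep_def by (simp add: subset_iff)

section \<open>Lexicographic orderings of finite subspaces are natural\<close>

text \<open>
  Gaussian elimination: starting from a vector with leading coefficient 1, its coordinates at
  the other leading indices are cleared in increasing order by subtracting multiples of vectors with
  those leads. Such a subtraction does not disturb smaller coordinates.
\<close>

lemma reduced_vector_exists:
  assumes rep: "lex_rep r W x" and fin: "finite W" and w0: "w0 \<in> W" "w0 \<noteq> 0"
  defines "I \<equiv> lead x ` (W - {0})"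
  shows "\<exists>w\<in>W. x (lead x w0) w = 1 \<and> (\<forall>m\<in>I. m \<noteq> lead x w0 \<longrightarrow> x m w = 0)"
proof -
  note lf = lex_rep_linear[OF rep] and W = subspace_of_rep[OF rep]
  define k where "k = lead x w0"
  have "\<exists>w\<in>W. x k w = 1 \<and> (\<forall>i<k. x i w = 0) \<and> (\<forall>m\<in>I. m \<noteq> k \<longrightarrow> m < n \<longrightarrow> x m w = 0)" for n
  proof (induction n)
    case 0
    have "x k w0 \<noteq> 0" "\<forall>i<k. x i w0 = 0" using at_lead[OF rep w0] before_lead[of _ x w0] by (auto simp: k_def)
    then show ?case using w0 W by (intro bexI[of _ "smul (1 / x k w0) w0"]) (auto simp: lf subspace_scale)
  next
    case (Suc n)
    then obtain w where w: "w \<in> W" "x k w = 1" "\<forall>i<k. x i w = 0" "\<forall>m\<in>I. m \<noteq> k \<longrightarrow> m < n \<longrightarrow> x m w = 0" by blast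
    show ?case
    proof (cases "n \<in> I \<and> k < n")
      case False
      then have "\<forall>m\<in>I. m \<noteq> k \<longrightarrow> m < Suc n \<longrightarrow> x m w = 0" using w(3,4) by (metis less_Suc_eq linorder_neqE_nat)
      then show ?thesis using w by blast
    next
      case True
      then obtain u where u: "u \<in> W" "u \<noteq> 0" "lead x u = n" by (auto simp: I_def)
      have xu: "x n u \<noteq> 0" "\<forall>i<n. x i u = 0" using at_lead[OF rep u(1,2)] before_lead[of _ x u] u by auto
      define w' where "w' = w - smul (x n w / x n u) u"
      have "x i w' = x i w" if "i < n" for i using xu that by (simp add: w'_def lf)
      moreover have "x n w' = 0" using xu by (simp add: w'_def lf)
      moreover have "w' \<in> W" using w u W by (simp add: w'_def subspace_diff subspace_scale)
      ultimately show ?thesis using w True by (intro bexI[of _ w']) (auto simp: less_Suc_eq)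
    qed
  qed
  note ex = this
  have "finite I" using fin by (simp add: I_def)
  then have "m < Suc (Max I)" if "m \<in> I" for m using that by (simp add: less_Suc_eq_le)
  then show ?thesis using ex[of "Suc (Max I)"] unfolding k_def by blast
qed

text \<open>
  The reduced vectors, listed by increasing lead, are a basis whose coordinates are the values of
  the forms at the leading indices. The remaining forms are determined on \<open>W\<close> by these and never decide a
  comparison, because vectors are compared at the lead of their difference.
\<close>

lemma natural_ordering_if_lex_rep:
  assumes rep: "lex_rep r W x" and fin: "finite W"
  shows "natural_ordering smul F W (Restr r W)"
proof -
  note lf = lex_rep_linear[OF rep] and W = subspace_of_rep[OF rep]
  define I where "I = lead x ` (W - {0})"
  have "\<forall>k\<in>I. \<exists>w\<in>W. x k w = 1 \<and> (\<forall>m\<in>I. m \<noteq> k \<longrightarrow> x m w = 0)"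
    using reduced_vector_exists[OF rep fin] by (auto simp: I_def)
  then obtain e where e: "\<And>k. k \<in> I \<Longrightarrow> e k \<in> W"
    and xe: "\<And>k m. k \<in> I \<Longrightarrow> m \<in> I \<Longrightarrow> x m (e k) = (if m = k then 1 else 0)"
    by metis
  have finI: "finite I" using fin by (simp add: I_def)
  have zero: "v = 0" if "v \<in> W" "\<And>m. m \<in> I \<Longrightarrow> x m v = 0" for v
    using at_lead[OF rep that(1)] that by (auto simp: I_def)
  have expand: "(\<Sum>k\<in>I. smul (x k v) (e k)) = v" if "v \<in> W" for v
  proof -
    have "v - (\<Sum>k\<in>I. smul (x k v) (e k)) = 0"
    proof (rule zero)
      show "v - (\<Sum>k\<in>I. smul (x k v) (e k)) \<in> W" 
        using W that e by (intro subspace_diff subspace_sum subspace_scale) auto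
      show "x m (v - (\<Sum>k\<in>I. smul (x k v) (e k))) = 0" if "m \<in> I" for m
        using that finI by (simp add: lf linear_form_sum[OF linear_form_of_rep[OF rep]] xe mult_delta_right)
    qed
    then show ?thesis by simp
  qed
  define L where "L = sorted_list_of_set I"
  have L: "set L = I" "distinct L" "sorted_wrt (<) L" using finI by (auto simp: L_def)
  have inj: "inj_on e I" using xe by (metis inj_onI zero_neq_one)
  define bs where "bs = map e L"
  have set_bs: "set bs = e ` I" and dist: "distinct bs" and len: "length bs = length L"
    using L inj by (auto simp: bs_def distinct_map)
  have indep: "independent (set bs)"
  proof (rule independent_if_scalars_zero)
    fix g a assume g: "(\<Sum>a\<in>set bs. smul (g a) a) = 0" and "a \<in> set bs"
    then obtain k where k: "k \<in> I" "a = e k" by (auto simp: set_bs)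
    have "0 = x k (\<Sum>a\<in>set bs. smul (g a) a)" by (simp add: g lf)
    also have "\<dots> = (\<Sum>m\<in>I. g (e m) * x k (e m))"
      by (simp add: set_bs sum.reindex[OF inj] linear_form_sum[OF linear_form_of_rep[OF rep]] lf)
    also have "\<dots> = g (e k)" using k finI by (simp add: xe mult_delta_right)
    finally show "g a = 0" using k by simp
  qed simp
  have span: "span (set bs) = W"
  proof
    show "span (set bs) \<subseteq> W" using W e by (intro span_minimal) (auto simp: set_bs)
    show "W \<subseteq> span (set bs)"
    proof
      fix v assume "v \<in> W"
      have "(\<Sum>k\<in>I. smul (x k v) (e k)) \<in> span (set bs)" 
        by (intro span_sum span_scale span_base) (auto simp: set_bs)
      then show "v \<in> span (set bs)" using expand[OF \<open>v \<in> W\<close>] by simp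
    qed
  qed
  have coord: "coord bs i v = x (L ! i) v" if "i < length L" "v \<in> W" for i v
  proof -
    have "v = (\<Sum>k\<in>I. smul (x k v) (e k))" using expand[OF that(2)] ..
    also have "\<dots> = lincomb smul bs (\<lambda>i. x (L ! i) v)"
      unfolding lincomb_def len
      by (subst sum.reindex_bij_betw[OF bij_betw_nth[OF L(2) refl L(1)[symmetric]], symmetric])
         (simp add: bs_def)
    finally show ?thesis using coord_lincomb[OF dist indep, of i] that len by metis
  qed
  have "(u, v) \<in> induced_ordering smul F bs \<longleftrightarrow> (u, v) \<in> r" if uv: "u \<in> W" "v \<in> W" for u v
  proof (cases "u = v")
    case True
    then show ?thesis using uv
      by (simp add: induced_ordering_iff[OF dist indep] less_iff_lex[OF rep] lex_less_def F_irrefl)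
  next
    case False
    have d: "v - u \<in> W" "v - u \<noteq> 0" using False uv W by (auto simp: subspace_diff)
    then have "lead x (v - u) \<in> set L" by (auto simp: L I_def)
    then obtain j where j: "j < length L" "L ! j = lead x (v - u)" by (metis in_set_conv_nth)
    have "lead (coord bs) (v - u) = j"
    proof (rule lead_eqI)
      show "coord bs j (v - u) \<noteq> 0" using at_lead[OF rep d] coord[OF j(1) d(1)] j by simp
      show "coord bs i (v - u) = 0" if "i < j" for i
        using coord[of i, OF _ d(1)] before_lead[of "L ! i" x "v - u"] that j 
          sorted_wrt_nth_less[OF L(3) that j(1)] by simp
    qed
    then show ?thesis
      using less_iff_lead[OF lex_rep_coord[OF dist indep], of u v] less_iff_lead[OF rep uv False] uv False j
        coord[OF j(1)] by (simp add: span)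
  qed
  then have "induced_ordering smul F bs = Restr r W"
    by (auto simp: induced_ordering_iff[OF dist indep] span)
  then show ?thesis unfolding natural_ordering_def using dist indep span by metis
qed

lemma in_X_space_if_lex_rep:
  assumes "lex_rep r UNIV x" shows "r \<in> X_space smul F"
  unfolding X_space_def
  using lex_rep_strict_linear[OF assms] natural_ordering_if_lex_rep lex_rep_subset[OF assms]
  by (auto simp: findim_subspace_iff)

section \<open>The sequence of classes\<close>

definition below :: "'v rel \<Rightarrow> 'v \<Rightarrow> 'v \<Rightarrow> bool" where
  "below r u v \<longleftrightarrow> u \<noteq> 0 \<and> v \<noteq> 0 \<and> (u, v) \<in> r \<and> (u, v) \<notin> sim_rel smul r"

lemma below_iff_lead:
  assumes "lex_rep r W x" "u \<in> W" "v \<in> W" "u \<noteq> 0" "v \<noteq> 0"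
  shows "below r u v \<longleftrightarrow> lead x v < lead x u"
  using less_iff_lead_less[OF assms] sim_iff_lead[OF assms] assms(4,5) by (auto simp: below_def)

lemma sim_nonzero: "(u, v) \<in> sim_rel smul r \<Longrightarrow> u \<noteq> 0 \<and> v \<noteq> 0"
  by (simp add: sim_rel_def)

context
  fixes r assumes r: "r \<in> X_space smul F"
begin

text \<open>
  All properties of \<open>\<sim>\<close> and \<open>below\<close> that involve three vectors are read off from their leads in a
  representation of the subspace that the vectors span.
\<close>

lemma three_levels:
  assumes "u \<noteq> 0" "v \<noteq> 0" "w \<noteq> 0"
  shows "\<exists>l :: 'v \<Rightarrow> nat. 
    ((u, v) \<in> sim_rel smul r \<longleftrightarrow> l u = l v) \<and> ((v, u) \<in> sim_rel smul r \<longleftrightarrow> l u = l v) \<and>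
    ((v, w) \<in> sim_rel smul r \<longleftrightarrow> l v = l w) \<and> ((u, w) \<in> sim_rel smul r \<longleftrightarrow> l u = l w) \<and>
    (below r u v \<longleftrightarrow> l v < l u) \<and> (below r v u \<longleftrightarrow> l u < l v) \<and>
    (below r v w \<longleftrightarrow> l w < l v) \<and> (below r u w \<longleftrightarrow> l w < l u)"
proof -
  obtain x where x: "lex_rep r (span {u, v, w}) x" using lex_rep_exists[OF r, of "{u, v, w}"] by auto
  have "u \<in> span {u, v, w}" "v \<in> span {u, v, w}" "w \<in> span {u, v, w}" by (auto intro: span_base)
  then show ?thesis using assms
    by (intro exI[of _ "lead x"]) (auto simp: sim_iff_lead[OF x] below_iff_lead[OF x])
qed

lemma sim_refl: "u \<noteq> 0 \<Longrightarrow> (u, u) \<in> sim_rel smul r"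
  using three_levels[of u u u] by auto

lemma sim_sym: "(u, v) \<in> sim_rel smul r \<Longrightarrow> (v, u) \<in> sim_rel smul r"
  using three_levels[of u v v] sim_nonzero[of u v r] by auto

lemma sim_trans: "(u, v) \<in> sim_rel smul r \<Longrightarrow> (v, w) \<in> sim_rel smul r \<Longrightarrow> (u, w) \<in> sim_rel smul r"
  using three_levels[of u v w] sim_nonzero[of u v r] sim_nonzero[of v w r] by auto

lemma below_sim: "below r u v \<Longrightarrow> (v, w) \<in> sim_rel smul r \<Longrightarrow> below r u w"
  using three_levels[of u v w] sim_nonzero[of v w r] below_def[of r u v] by auto

lemma sim_below: "(u, v) \<in> sim_rel smul r \<Longrightarrow> below r v w \<Longrightarrow> below r u w"
  using three_levels[of u v w] sim_nonzero[of u v r] below_def[of r v w] by auto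

lemma below_trans: "below r u v \<Longrightarrow> below r v w \<Longrightarrow> below r u w"
  using three_levels[of u v w] below_def[of r u v] below_def[of r v w] by auto

lemma below_asym: "below r u v \<Longrightarrow> \<not> below r v u"
  using three_levels[of u v v] below_def[of r u v] by auto

lemma equiv_sim: "equiv (UNIV - {0}) (sim_rel smul r)"
proof (rule equivI)
  show "refl_on (UNIV - {0}) (sim_rel smul r)" using sim_refl by (simp add: refl_on_def)
  show "sim_rel smul r \<subseteq> (UNIV - {0}) \<times> (UNIV - {0})" by (auto simp: sim_rel_def)
  show "sym (sim_rel smul r)" using sim_sym by (rule symI)
  show "trans (sim_rel smul r)" using sim_trans by (rule transI)
qed

end

text \<open>
  A level function numbers the classes from the largest one downwards; it exists exactly when
  the classes have order type \<open>\<omega>\<^sup>*\<close>.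
\<close>

definition level_fun :: "'v rel \<Rightarrow> ('v \<Rightarrow> nat) \<Rightarrow> bool" where
  "level_fun r l \<longleftrightarrow> (\<forall>u v. u \<noteq> 0 \<longrightarrow> v \<noteq> 0 \<longrightarrow>
      ((u, v) \<in> sim_rel smul r \<longleftrightarrow> l u = l v) \<and> (below r u v \<longleftrightarrow> l v < l u)) \<and>
    (\<forall>i. \<exists>u. u \<noteq> 0 \<and> l u = i)"

text \<open>
  The recursion describes the \<open>i\<close>-th class from the top using quantifiers over vectors only. There
  are countably many vectors, so membership in a class depends measurably on the ordering.
\<close>

primrec at_level :: "'v rel \<Rightarrow> nat \<Rightarrow> 'v \<Rightarrow> bool" where
  "at_level r 0 w \<longleftrightarrow> w \<noteq> 0 \<and> (\<forall>u. u = 0 \<or> (u, w) \<in> sim_rel smul r \<or> below r u w)"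
| "at_level r (Suc n) w \<longleftrightarrow> (\<exists>w'. at_level r n w' \<and> below r w w' \<and>
     (\<forall>u. \<not> below r u w' \<or> (u, w) \<in> sim_rel smul r \<or> below r u w))"

lemma at_level_iff_level_fun:
  assumes "level_fun r l"
  shows "at_level r i w \<longleftrightarrow> w \<noteq> 0 \<and> l w = i"
proof (induction i arbitrary: w)
  case 0
  have ex: "\<exists>u. u \<noteq> 0 \<and> l u = 0" using assms by (simp add: level_fun_def)
  have sb: "(u, v) \<in> sim_rel smul r \<longleftrightarrow> l u = l v" "below r u v \<longleftrightarrow> l v < l u" if "u \<noteq> 0" "v \<noteq> 0" for u v
    using assms that by (auto simp: level_fun_def)
  show ?case
  proof
    assume a: "at_level r 0 w"
    obtain u where u: "u \<noteq> 0" "l u = 0" using ex by blast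
    then show "w \<noteq> 0 \<and> l w = 0" using a sb[of u w] by auto
  qed (use sb in \<open>auto simp: neq_iff\<close>)
next
  case (Suc i)
  have ex: "\<exists>u. u \<noteq> 0 \<and> l u = k" for k using assms by (simp add: level_fun_def)
  have sb: "(u, v) \<in> sim_rel smul r \<longleftrightarrow> l u = l v" "below r u v \<longleftrightarrow> l v < l u" if "u \<noteq> 0" "v \<noteq> 0" for u v
    using assms that by (auto simp: level_fun_def)
  have b0: "u \<noteq> 0 \<and> v \<noteq> 0" if "below r u v" for u v using that by (simp add: below_def)
  show ?case
  proof
    assume "at_level r (Suc i) w"
    then obtain w' where w': "w' \<noteq> 0" "l w' = i" "below r w w'" 
      "\<And>u. below r u w' \<Longrightarrow> (u, w) \<in> sim_rel smul r \<or> below r u w" using Suc by auto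
    obtain u where u: "u \<noteq> 0" "l u = Suc i" using ex by blast
    have "below r u w'" using sb u w' by simp
    then have "l w \<le> l u" using w'(4)[of u] sb[of u w] u b0[OF w'(3)] by auto
    then show "w \<noteq> 0 \<and> l w = Suc i" using sb[of w w'] w' u b0[OF w'(3)] by auto
  next
    assume w: "w \<noteq> 0 \<and> l w = Suc i"
    obtain w' where w': "w' \<noteq> 0" "l w' = i" using ex by blast
    have "(u, w) \<in> sim_rel smul r \<or> below r u w" if "below r u w'" for u
      using b0[OF that] sb[of u w'] sb[of u w] w w' that by auto
    then show "at_level r (Suc i) w" using w w' Suc sb[of w w'] by auto
  qed
qed

lemma decreasing_enum_if_level_fun:
  assumes r: "r \<in> X_space smul F" and l: "level_fun r l"
  shows "decreasing_enum smul r (\<lambda>i. {w. w \<noteq> 0 \<and> l w = i})"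
proof -
  have ex: "\<exists>u. u \<noteq> 0 \<and> l u = k" for k using l by (simp add: level_fun_def)
  have sb: "(u, v) \<in> sim_rel smul r \<longleftrightarrow> l u = l v" "below r u v \<longleftrightarrow> l v < l u" if "u \<noteq> 0" "v \<noteq> 0" for u v
    using l that by (auto simp: level_fun_def)
  have cls: "sim_rel smul r `` {w} = {v. v \<noteq> 0 \<and> l v = l w}" if "w \<noteq> 0" for w
  proof -
    have "(w, v) \<in> sim_rel smul r \<longleftrightarrow> v \<noteq> 0 \<and> l v = l w" for v
      using sb(1)[OF that, of v] sim_nonzero[of w v r] by auto
    then show ?thesis by auto
  qed
  have "sim_classes smul r = range (\<lambda>i. {w. w \<noteq> 0 \<and> l w = i})"
  proof
    show "sim_classes smul r \<subseteq> range (\<lambda>i. {w. w \<noteq> 0 \<and> l w = i})"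
      by (auto simp: sim_classes_def quotient_def cls)
    show "range (\<lambda>i. {w. w \<noteq> 0 \<and> l w = i}) \<subseteq> sim_classes smul r"
    proof (clarify)
      fix i :: nat
      obtain u where u: "u \<noteq> 0" "l u = i" using ex by blast
      then show "{w. w \<noteq> 0 \<and> l w = i} \<in> sim_classes smul r" using cls[of u]
        by (auto simp: sim_classes_def quotient_def)
    qed
  qed
  moreover have "inj (\<lambda>i. {w. w \<noteq> 0 \<and> l w = i})" 
  proof (rule injI)
    fix i j assume e: "{w. w \<noteq> 0 \<and> l w = i} = {w. w \<noteq> 0 \<and> l w = j}"
    obtain u where "u \<noteq> 0" "l u = i" using ex by blast
    then have "u \<in> {w. w \<noteq> 0 \<and> l w = j}" unfolding e[symmetric] by simp
    then show "i = j" using \<open>l u = i\<close> by simp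
  qed
  moreover have "class_less r {w. w \<noteq> 0 \<and> l w = j} {w. w \<noteq> 0 \<and> l w = i}" if "i < j" for i j
    using sb(2) that by (auto simp: class_less_def below_def)
  ultimately show ?thesis by (simp add: decreasing_enum_def bij_betw_def)
qed

lemma level_fun_if_decreasing_enum:
  assumes r: "r \<in> X_space smul F" and e: "decreasing_enum smul r \<alpha>"
  shows "\<exists>l. level_fun r l \<and> (\<forall>i. \<alpha> i = {w. w \<noteq> 0 \<and> l w = i})"
proof -
  let ?S = "sim_rel smul r"
  have bij: "bij_betw \<alpha> UNIV (sim_classes smul r)" 
    and less: "i < j \<Longrightarrow> u \<in> \<alpha> j \<Longrightarrow> v \<in> \<alpha> i \<Longrightarrow> (u, v) \<in> r" for i j u v
    using e by (auto simp: decreasing_enum_def class_less_def)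
  have cl: "\<alpha> i \<in> (UNIV - {0}) // ?S" for i using bij by (auto simp: bij_betw_def sim_classes_def)
  have ne: "\<exists>u. u \<in> \<alpha> i" for i using in_quotient_imp_non_empty[OF equiv_sim[OF r] cl] by blast
  have nz: "u \<noteq> 0" if "u \<in> \<alpha> i" for u i using in_quotient_imp_subset[OF equiv_sim[OF r] cl] that by blast
  have sim: "(u, v) \<in> ?S \<longleftrightarrow> i = j" if "u \<in> \<alpha> i" "v \<in> \<alpha> j" for u v i j
    using quotient_eq_iff[OF equiv_sim[OF r] cl[of i] cl[of j] that] bij 
    by (auto simp: bij_betw_def inj_def)
  have cov: "\<exists>i. u \<in> \<alpha> i" if "u \<noteq> 0" for u
  proof -
    have "?S `` {u} \<in> range \<alpha>" using bij that by (auto simp: bij_betw_def sim_classes_def quotient_def)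
    moreover have "u \<in> ?S `` {u}" using sim_refl[OF r that] by simp
    ultimately show ?thesis by auto
  qed
  define l where "l u = (THE i. u \<in> \<alpha> i)" for u
  have l: "l u = i" if "u \<in> \<alpha> i" for u i 
    unfolding l_def using sim[OF _ that] sim_refl[OF r nz[OF that]] that by (intro the_equality) auto
  have below: "below r u v \<longleftrightarrow> j < i" if "u \<in> \<alpha> i" "v \<in> \<alpha> j" for u v i j
  proof
    assume "j < i" then show "below r u v" using less[OF _ that] sim[OF that] nz that by (auto simp: below_def)
  next
    assume b: "below r u v"
    have "\<not> i < j" 
    proof
      assume "i < j"
      then have "below r v u" using less[OF _ that(2,1)] sim[OF that(2,1)] nz that by (auto simp: below_def)
      then show False using b below_asym[OF r] by blast
    qed
    moreover have "i \<noteq> j" using b sim[OF that] by (auto simp: below_def)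
    ultimately show "j < i" by simp
  qed
  have "level_fun r l"
    unfolding level_fun_def
  proof (intro conjI allI impI)
    fix u v :: 'v assume "u \<noteq> 0" "v \<noteq> 0"
    then obtain i j where ij: "u \<in> \<alpha> i" "v \<in> \<alpha> j" using cov by blast
    show "(u, v) \<in> sim_rel smul r \<longleftrightarrow> l u = l v" "below r u v \<longleftrightarrow> l v < l u" 
      using sim[OF ij] below[OF ij] l[OF ij(1)] l[OF ij(2)] by auto
  next
    fix i 
    obtain u where "u \<in> \<alpha> i" using ne by blast
    then show "\<exists>u. u \<noteq> 0 \<and> l u = i" using nz[of u i] l[of u i] by auto
  qed
  moreover have "w \<in> \<alpha> i \<longleftrightarrow> w \<noteq> 0 \<and> l w = i" for i w 
    using nz[of w i] l[of w] cov[of w] by auto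
  then have "\<forall>i. \<alpha> i = {w. w \<noteq> 0 \<and> l w = i}" by auto
  ultimately show ?thesis by (intro exI[of _ l] conjI)
qed

lemma sim_class_level:
  assumes r: "r \<in> X_space smul F" and l: "level_fun r l"
  shows "sim_class smul r i = {w. w \<noteq> 0 \<and> l w = i}"
proof -
  have "sim_class smul r = (\<lambda>i. {w. w \<noteq> 0 \<and> l w = i})"
    unfolding sim_class_def
  proof (rule the_equality)
    show "decreasing_enum smul r (\<lambda>i. {w. w \<noteq> 0 \<and> l w = i})" 
      by (rule decreasing_enum_if_level_fun[OF r l])
    fix \<alpha> assume "decreasing_enum smul r \<alpha>"
    then obtain l' where l': "level_fun r l'" "\<And>i. \<alpha> i = {w. w \<noteq> 0 \<and> l' w = i}"
      using level_fun_if_decreasing_enum[OF r] by blast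
    show "\<alpha> = (\<lambda>i. {w. w \<noteq> 0 \<and> l w = i})"
      unfolding l'(2)[abs_def] fun_eq_iff set_eq_iff mem_Collect_eq
        at_level_iff_level_fun[OF l, symmetric] at_level_iff_level_fun[OF l'(1), symmetric] by simp
  qed
  then show ?thesis by simp
qed

lemma N_omega_iff_level_fun: "r \<in> N_omega smul F \<longleftrightarrow> r \<in> X_space smul F \<and> (\<exists>l. level_fun r l)"
proof
  assume "r \<in> N_omega smul F"
  then obtain \<alpha> where "r \<in> X_space smul F" "decreasing_enum smul r \<alpha>" by (auto simp: N_omega_def)
  then show "r \<in> X_space smul F \<and> (\<exists>l. level_fun r l)" using level_fun_if_decreasing_enum by metis
next
  assume "r \<in> X_space smul F \<and> (\<exists>l. level_fun r l)"
  then obtain l where r: "r \<in> X_space smul F" and l: "level_fun r l" by auto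
  show "r \<in> N_omega smul F"
    unfolding N_omega_def using r decreasing_enum_if_level_fun[OF r l] by auto
qed

text \<open>
  Two classes that lie immediately below the same class coincide, so by induction a level is
  a single class.
\<close>

lemma at_level_sim_iff:
  assumes r: "r \<in> X_space smul F" and w: "at_level r i w"
  shows "at_level r i u \<longleftrightarrow> (u, w) \<in> sim_rel smul r"
  using w
proof (induction i arbitrary: u w)
  case 0
  show ?case
  proof
    assume "at_level r 0 u"
    then have "(w, u) \<in> sim_rel smul r \<or> below r w u" "(u, w) \<in> sim_rel smul r \<or> below r u w"
      using 0 by simp_all blast+
    then show "(u, w) \<in> sim_rel smul r" using below_asym[OF r] sim_sym[OF r] by blast
  next
    assume s: "(u, w) \<in> sim_rel smul r"
    have "v = 0 \<or> (v, u) \<in> sim_rel smul r \<or> below r v u" for v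
    proof -
      have "v = 0 \<or> (v, w) \<in> sim_rel smul r \<or> below r v w" using 0 by simp
      then show ?thesis using sim_trans[OF r _ sim_sym[OF r s], of v] below_sim[OF r _ sim_sym[OF r s], of v] by blast
    qed
    then show "at_level r 0 u" using sim_nonzero[OF s] by simp
  qed
next
  case (Suc i)
  obtain w' where w': "at_level r i w'" "below r w w'" 
      "\<And>v. below r v w' \<Longrightarrow> (v, w) \<in> sim_rel smul r \<or> below r v w" using Suc.prems by auto
  show ?case
  proof
    assume "at_level r (Suc i) u"
    then obtain u' where u': "at_level r i u'" "below r u u'" 
      "\<And>v. below r v u' \<Longrightarrow> (v, u) \<in> sim_rel smul r \<or> below r v u" by auto
    have s: "(u', w') \<in> sim_rel smul r" using Suc.IH[OF w'(1)] u'(1) by simp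
    have "below r u w'" "below r w u'" 
      using below_sim[OF r u'(2) s] below_sim[OF r w'(2) sim_sym[OF r s]] by simp_all
    then have "(u, w) \<in> sim_rel smul r \<or> below r u w" "(w, u) \<in> sim_rel smul r \<or> below r w u"
      using u'(3) w'(3) by simp_all
    then show "(u, w) \<in> sim_rel smul r" using below_asym[OF r, of u w] sim_sym[OF r, of w u] by blast
  next
    assume s: "(u, w) \<in> sim_rel smul r"
    then have "below r u w'" using sim_below[OF r s w'(2)] by simp
    moreover have "(v, u) \<in> sim_rel smul r \<or> below r v u" if "below r v w'" for v
      using w'(3)[OF that] sim_trans[OF r _ sim_sym[OF r s], of v] below_sim[OF r _ sim_sym[OF r s], of v] by blast
    ultimately show "at_level r (Suc i) u" using w'(1) by auto
  qed
qed

lemma at_level_below: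
  assumes r: "r \<in> X_space smul F"
  shows "at_level r i w \<Longrightarrow> at_level r j u \<Longrightarrow> i < j \<Longrightarrow> below r u w"
proof (induction j arbitrary: u)
  case (Suc j)
  then obtain u' where u': "at_level r j u'" "below r u u'" by auto
  show ?case
  proof (cases "i = j")
    case True
    then show ?thesis using u' at_level_sim_iff[OF r Suc.prems(1), of u'] below_sim[OF r u'(2), of w] by simp
  next
    case False
    then show ?thesis using Suc.IH[OF Suc.prems(1) u'(1)] Suc.prems(3) below_trans[OF r u'(2)] by simp
  qed
qed simp

text \<open>
  The conditions on the right say that the process of passing from a class to the next lower one
  never stops and exhausts all vectors.
\<close>

lemma N_omega_iff_at_level:
  "r \<in> N_omega smul F \<longleftrightarrow> r \<in> X_space smul F \<and> (\<forall>i. \<exists>w. at_level r i w) \<and> 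
     (\<forall>v. v = 0 \<or> (\<exists>i. at_level r i v))"
proof
  assume "r \<in> N_omega smul F"
  then obtain l where rl: "r \<in> X_space smul F" "level_fun r l" by (auto simp: N_omega_iff_level_fun)
  then have "\<forall>i. \<exists>w. w \<noteq> 0 \<and> l w = i" by (simp add: level_fun_def)
  then show "r \<in> X_space smul F \<and> (\<forall>i. \<exists>w. at_level r i w) \<and> (\<forall>v. v = 0 \<or> (\<exists>i. at_level r i v))"
    using rl at_level_iff_level_fun[OF rl(2)] by auto
next
  assume a: "r \<in> X_space smul F \<and> (\<forall>i. \<exists>w. at_level r i w) \<and> (\<forall>v. v = 0 \<or> (\<exists>i. at_level r i v))"
  then have r: "r \<in> X_space smul F" by blast
  obtain l where l: "\<And>v. v \<noteq> 0 \<Longrightarrow> at_level r (l v) v" using a by metis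
  have nz: "v \<noteq> 0" if "at_level r i v" for i v using that by (cases i) (auto simp: below_def)
  have uniq: "l v = i" if "at_level r i v" for i v
  proof -
    have v: "at_level r (l v) v" using l[OF nz[OF that]] .
    show ?thesis
      using at_level_below[OF r v that] at_level_below[OF r that v] below_asym[OF r, of v v] 
      by (cases "l v" i rule: linorder_cases) auto
  qed
  have "level_fun r l"
    unfolding level_fun_def
  proof (intro conjI allI impI)
    fix u v :: 'v assume uv: "u \<noteq> 0" "v \<noteq> 0"
    show s: "(u, v) \<in> sim_rel smul r \<longleftrightarrow> l u = l v"
      using at_level_sim_iff[OF r l[OF uv(2)], of u] l[OF uv(1)] uniq[of "l v" u] by auto
    show "below r u v \<longleftrightarrow> l v < l u"
      using at_level_below[OF r l[OF uv(1)] l[OF uv(2)]] at_level_below[OF r l[OF uv(2)] l[OF uv(1)]] 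
        below_asym[OF r, of u v] s by (cases "l u" "l v" rule: linorder_cases) (auto simp: below_def)
  next
    fix i 
    obtain u where "at_level r i u" using a by blast
    then show "\<exists>u. u \<noteq> 0 \<and> l u = i" using nz[of i u] uniq[of i u] by auto
  qed
  then show "r \<in> N_omega smul F" using r N_omega_iff_level_fun by blast
qed

section \<open>The coefficients of an ordering\<close>

definition normalised :: "'v rel \<Rightarrow> 'v \<Rightarrow> bool" where
  "normalised r w \<longleftrightarrow> (\<forall>c. c \<noteq> 0 \<longrightarrow> w = smul c w \<or> (w, smul c w) \<in> r)"

lemma class_rep_props:
  assumes r: "r \<in> X_space smul F" and l: "level_fun r l"
  shows "class_rep smul r i \<noteq> 0" "l (class_rep smul r i) = i" "normalised r (class_rep smul r i)"
proof -
  obtain w where w: "w \<noteq> 0" "l w = i" using l unfolding level_fun_def by blast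
  obtain x where x: "lex_rep r (span {w}) x" using lex_rep_exists[OF r, of "{w}"] by auto
  define c where "c = 1 / x (lead x w) w"
  have nz: "x (lead x w) w \<noteq> 0" using at_lead[OF x _ w(1)] span_base by blast
  have c: "c \<noteq> 0" using nz by (simp add: c_def)
  have cw: "smul c w \<in> span {w}" "w \<in> span {w}" "smul c w \<noteq> 0" using c w by (auto intro: span_scale span_base)
  have "x (lead x (smul c w)) (smul c w) = 1" 
    unfolding lead_scale[OF x c] using nz by (simp add: lex_rep_linear[OF x] c_def)
  then have "normalised r (smul c w)" using normalised_iff[OF x cw(1,3)] by (simp add: normalised_def)
  moreover have "(smul c w, w) \<in> sim_rel smul r" 
    using sim_iff_lead[OF x cw(1,2,3) w(1)] lead_scale[OF x c] by simp
  then have "l (smul c w) = i" using l w cw(3) by (auto simp: level_fun_def)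
  ultimately have "\<exists>w. w \<in> sim_class smul r i \<and> normalised r w"
    using cw(3) by (intro exI[of _ "smul c w"] conjI) (simp_all add: sim_class_level[OF r l])
  then have "class_rep smul r i \<in> sim_class smul r i \<and> normalised r (class_rep smul r i)"
    unfolding class_rep_def normalised_def[symmetric] by (rule someI_ex)
  then show "class_rep smul r i \<noteq> 0" "l (class_rep smul r i) = i" "normalised r (class_rep smul r i)"
    by (auto simp: sim_class_level[OF r l])
qed

text \<open>
  The right-hand side can be evaluated in any representation of any subspace containing \<open>v\<close> and
  the representative, which is how properties of finite-dimensional subspaces transfer to the
  coefficients.
\<close>

lemma phi_ord_eq:
  assumes r: "r \<in> X_space smul F" and l: "level_fun r l"
    and x: "lex_rep r W x" "class_rep smul r i \<in> W" "v \<in> W"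
  shows "phi_ord smul r v i = x (lead x (class_rep smul r i)) v"
proof -
  note cr = class_rep_props[OF r l, of i]
  have "x (lead x (class_rep smul r i)) (class_rep smul r i) = 1"
    using normalised_iff[OF x(1,2) cr(1)] cr(3) by (simp add: normalised_def)
  note coefficient_iff[OF x(1,2) cr(1) this x(3)]
  then show ?thesis unfolding phi_ord_def by simp
qed

text \<open>
  Each claim concerns finitely many vectors and is checked in a representation \<open>x\<close> of their span.
  If \<open>z = v - u\<close> has level \<open>i\<close>, the representative \<open>w\<^sub>i\<close> has the same lead as \<open>z\<close>, so the
  \<open>i\<close>-th coefficients are the coordinates where \<open>u\<close> and \<open>v\<close> are compared; the coefficients of \<open>z\<close> at
  smaller levels vanish.
\<close>

lemma lex_rep_phi_ord:
  assumes r: "r \<in> X_space smul F" and l: "level_fun r l"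
  shows "lex_rep r UNIV (\<lambda>i v. phi_ord smul r v i)"
    and "z \<noteq> 0 \<Longrightarrow> lead (\<lambda>i v. phi_ord smul r v i) z = l z"
proof -
  let ?w = "class_rep smul r" and ?c = "\<lambda>i v. phi_ord smul r v i"
  have lev: "(u, v) \<in> sim_rel smul r \<longleftrightarrow> l u = l v" "below r u v \<longleftrightarrow> l v < l u" if "u \<noteq> 0" "v \<noteq> 0" for u v
    using l that by (auto simp: level_fun_def)
  note cr = class_rep_props[OF r l]
  have lin: "linear_form (?c i)" for i
    unfolding linear_form_def
  proof (intro conjI allI)
    fix u v
    obtain x where x: "lex_rep r (span {?w i, u, v}) x" using lex_rep_exists[OF r, of "{?w i, u, v}"] by auto
    have in_span: "?w i \<in> span {?w i, u, v}" "u \<in> span {?w i, u, v}" "v \<in> span {?w i, u, v}"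
       by (auto intro: span_base)
    have "u + v \<in> span {?w i, u, v}" using in_span span_add by blast
    then show "?c i (u + v) = ?c i u + ?c i v"
      by (simp add: phi_ord_eq[OF r l x] in_span lex_rep_linear[OF x])
  next
    fix d v
    obtain x where x: "lex_rep r (span {?w i, v}) x" using lex_rep_exists[OF r, of "{?w i, v}"] by auto
    have in_span: "?w i \<in> span {?w i, v}" "v \<in> span {?w i, v}" by (auto intro: span_base)
    have "smul d v \<in> span {?w i, v}" using in_span span_scale by blast
    then show "?c i (smul d v) = d * ?c i v"
      by (simp add: phi_ord_eq[OF r l x] in_span lex_rep_linear[OF x])
  qed
  have coef: "(i = l z \<longrightarrow> ?c i z \<noteq> 0) \<and> (i < l z \<longrightarrow> ?c i z = 0)" if z: "z \<noteq> 0" for i z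
  proof -
    obtain x where x: "lex_rep r (span {?w i, z}) x" using lex_rep_exists[OF r, of "{?w i, z}"] by auto
    have in_span: "?w i \<in> span {?w i, z}" "z \<in> span {?w i, z}" by (auto intro: span_base)
    have *: "?c i z = x (lead x (?w i)) z" by (rule phi_ord_eq[OF r l x in_span])
    show ?thesis
      using sim_iff_lead[OF x in_span cr(1) z] below_iff_lead[OF x in_span(2,1) z cr(1)]
        lev[OF cr(1) z, of i] lev[OF z cr(1), of i] cr(2)[of i] at_lead[OF x in_span(2) z] 
        before_lead[of _ x z] * by auto
  qed
  have less: "(u, v) \<in> r \<longleftrightarrow> lex_less ?c u v" for u v
  proof (cases "u = v")
    case True
    have "(u, u) \<notin> r" using r by (auto simp: X_space_def strict_linear_order_on_def irrefl_def)
    then show ?thesis using True by (simp add: lex_less_def F_irrefl)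
  next
    case False
    define z where "z = v - u"
    define i where "i = l z"
    have z: "z \<noteq> 0" using False by (simp add: z_def)
    obtain x where x: "lex_rep r (span {?w i, u, v}) x" using lex_rep_exists[OF r, of "{?w i, u, v}"] by auto
    have in_span: "?w i \<in> span {?w i, u, v}" "u \<in> span {?w i, u, v}" "v \<in> span {?w i, u, v}"
       by (auto intro: span_base)
    then have zs: "z \<in> span {?w i, u, v}" unfolding z_def using span_diff by blast
    have "lead x z = lead x (?w i)"
      using sim_iff_lead[OF x zs in_span(1) z cr(1)] lev[OF z cr(1), of i] cr(2) by (simp add: i_def)
    then have "(u, v) \<in> r \<longleftrightarrow> (?c i u, ?c i v) \<in> F"
      using less_iff_lead[OF x in_span(2,3) False] phi_ord_eq[OF r l x in_span(1)] in_span(2,3)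
      by (simp add: z_def)
    moreover have "?c i z = ?c i v - ?c i u" for i by (simp add: z_def linear_form_simps[OF lin])
    then have "?c k u = ?c k v" if "k < i" for k using coef[OF z, of k] that i_def by auto
    moreover have "?c i u \<noteq> ?c i v" using coef[OF z, of i] \<open>\<And>i. ?c i z = ?c i v - ?c i u\<close> i_def by auto
    ultimately show ?thesis unfolding lex_less_def using F_irrefl by (metis linorder_neqE_nat)
  qed
  moreover have "\<exists>i. ?c i v \<noteq> 0" if "v \<noteq> 0" for v using coef[OF that] by blast
  ultimately show "lex_rep r UNIV ?c" unfolding lex_rep_def using lin by (simp add: subspace_UNIV)
  show "z \<noteq> 0 \<Longrightarrow> lead ?c z = l z" using coef[of z] by (intro lead_eqI) auto
qed

lemma level_fun_lead:
  assumes x: "lex_rep r UNIV x" and surj: "\<And>i. \<exists>v. v \<noteq> 0 \<and> lead x v = i"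
  shows "level_fun r (lead x)"
  unfolding level_fun_def using sim_iff_lead[OF x] below_iff_lead[OF x] surj by auto

text \<open>
  Conversely, forms that represent an ordering and attain every lead are recovered as its coefficients.
\<close>

lemma phi_ord_lead:
  assumes x: "lex_rep r UNIV x" and surj: "\<And>i. \<exists>v. v \<noteq> 0 \<and> lead x v = i"
  shows "phi_ord smul r v i = x i v"
  using phi_ord_eq[OF in_X_space_if_lex_rep[OF x] level_fun_lead[OF x surj] x, of i v]
    class_rep_props(2)[OF in_X_space_if_lex_rep[OF x] level_fun_lead[OF x surj]] by simp

end

section \<open>Orderings from matrices\<close>

locale ordered_basis = ordered_scalars smul F
  for smul :: "'f::{field,finite} \<Rightarrow> 'v::ab_group_add \<Rightarrow> 'v" and F +
  fixes b :: "nat \<Rightarrow> 'v"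
  assumes inj_b: "inj b" and indep_b: "independent (range b)" and span_b: "span (range b) = UNIV"
begin

definition coeffs :: "'v \<Rightarrow> nat \<Rightarrow> 'f" where
  "coeffs v j = representation (range b) v (b j)"

text \<open>
  The linear form that takes the value \<open>M j i\<close> at \<open>b j\<close>.
\<close>

definition extend :: "(nat \<Rightarrow> nat \<Rightarrow> 'f) \<Rightarrow> nat \<Rightarrow> 'v \<Rightarrow> 'f" where
  "extend M i v = (\<Sum>j | coeffs v j \<noteq> 0. coeffs v j * M j i)"

lemma finite_coeffs: "finite {j. coeffs v j \<noteq> 0}"
proof -
  have "finite (b -` {x. representation (range b) v x \<noteq> 0})"
    using finite_representation inj_b by (rule finite_vimageI)
  then show ?thesis by (simp add: coeffs_def vimage_def)
qed

lemma coeffs_add: "coeffs (u + v) j = coeffs u j + coeffs v j"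
  and coeffs_scale: "coeffs (smul c v) j = c * coeffs v j"
  using indep_b span_b by (simp_all add: coeffs_def representation_add representation_scale)

lemma coeffs_basis: "coeffs (b k) j = (if j = k then 1 else 0)"
  using inj_b by (simp add: coeffs_def representation_basis[OF indep_b rangeI] inj_eq)

lemma coeffs_expand: 
  assumes "finite J" "{j. coeffs v j \<noteq> 0} \<subseteq> J"
  shows "(\<Sum>j\<in>J. smul (coeffs v j) (b j)) = v"
proof -
  have "(\<Sum>j\<in>J. smul (coeffs v j) (b j)) = (\<Sum>x\<in>b ` J. smul (representation (range b) v x) x)"
    using inj_b by (simp add: sum.reindex inj_on_subset coeffs_def)
  also have "\<dots> = (\<Sum>x | representation (range b) v x \<noteq> 0. smul (representation (range b) v x) x)"
  proof (rule sum.mono_neutral_right)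
    show "{x. representation (range b) v x \<noteq> 0} \<subseteq> b ` J"
    proof clarify
      fix x assume x: "representation (range b) v x \<noteq> 0"
      then obtain j where "x = b j" using representation_ne_zero by blast
      then show "x \<in> b ` J" using assms x by (auto simp: coeffs_def)
    qed
  qed (use assms in auto)
  also have "\<dots> = v" using sum_nonzero_representation_eq[OF indep_b] span_b by simp
  finally show ?thesis .
qed

lemma extend_superset:
  assumes "finite J" "{j. coeffs v j \<noteq> 0} \<subseteq> J"
  shows "extend M i v = (\<Sum>j\<in>J. coeffs v j * M j i)"
  unfolding extend_def using assms by (intro sum.mono_neutral_left) auto

lemma linear_form_extend: "linear_form (extend M i)"
  unfolding linear_form_def
proof (intro conjI allI)
  fix u v
  let ?J = "{j. coeffs u j \<noteq> 0} \<union> {j. coeffs v j \<noteq> 0}"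
  have f: "finite ?J" using finite_coeffs by simp
  have "{j. coeffs (u + v) j \<noteq> 0} \<subseteq> ?J" by (auto simp: coeffs_add)
  then show "extend M i (u + v) = extend M i u + extend M i v"
    by (subst (1 2 3) extend_superset[OF f]) (auto simp: coeffs_add distrib_right sum.distrib)
next
  fix c v
  show "extend M i (smul c v) = c * extend M i v"
    by (subst (1 2) extend_superset[OF finite_coeffs[of v]]) 
       (auto simp: coeffs_scale sum_distrib_left mult.assoc)
qed

lemma extend_basis_vector [simp]: "extend M i (b j) = M j i"
  by (subst extend_superset[of "{j}"]) (auto simp: coeffs_basis)

lemma linear_form_eq_extend:
  assumes "linear_form f" "\<And>j. f (b j) = M j i"
  shows "f v = extend M i v"
proof -
  have "f v = f (\<Sum>j | coeffs v j \<noteq> 0. smul (coeffs v j) (b j))" 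
    using coeffs_expand[OF finite_coeffs] by simp
  also have "\<dots> = extend M i v"
    using assms by (simp add: extend_def linear_form_sum linear_form_simps)
  finally show ?thesis .
qed

definition lex_order :: "(nat \<Rightarrow> nat \<Rightarrow> 'f) \<Rightarrow> 'v rel" where
  "lex_order M = {(u, v). lex_less (extend M) u v}"

text \<open>
  The second condition makes the lead of a vector its level: if some index were not a lead,
  the numbering of the classes would skip it and \<open>phi\<close> would drop that column of the matrix.
\<close>

definition regular :: "(nat \<Rightarrow> nat \<Rightarrow> 'f) set" where
  "regular = {M. (\<forall>v. v \<noteq> 0 \<longrightarrow> (\<exists>i. extend M i v \<noteq> 0)) \<and>
     (\<forall>i. \<exists>v. (\<forall>k<i. extend M k v = 0) \<and> extend M i v \<noteq> 0)}"

lemma lex_rep_lex_order: "M \<in> regular \<Longrightarrow> lex_rep (lex_order M) UNIV (extend M)"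
  by (simp add: lex_rep_def lex_order_def regular_def linear_form_extend subspace_UNIV)

lemma regular_lead: 
  assumes "M \<in> regular" shows "\<exists>v. v \<noteq> 0 \<and> lead (extend M) v = i"
proof -
  obtain v where v: "\<forall>k<i. extend M k v = 0" "extend M i v \<noteq> 0" using assms unfolding regular_def by blast
  then have "lead (extend M) v = i" by (intro lead_eqI) auto
  moreover have "v \<noteq> 0" using v(2) linear_form_simps(3)[OF linear_form_extend] by auto
  ultimately show ?thesis by blast
qed

lemma lex_order_in_N_omega: 
  assumes "M \<in> regular" shows "lex_order M \<in> N_omega smul F"
proof -
  note rep = lex_rep_lex_order[OF assms]
  show ?thesis unfolding N_omega_iff_level_fun
    using in_X_space_if_lex_rep[OF rep] level_fun_lead[OF rep regular_lead[OF assms]] by auto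
qed

lemma phi_lex_order: "M \<in> regular \<Longrightarrow> phi smul b (lex_order M) = M"
  by (simp add: phi_def fun_eq_iff phi_ord_lead[OF lex_rep_lex_order regular_lead])

lemma extend_phi:
  assumes "r \<in> N_omega smul F"
  shows "extend (phi smul b r) = (\<lambda>i v. phi_ord smul r v i)"
proof -
  obtain l where l: "r \<in> X_space smul F" "level_fun r l" using assms by (auto simp: N_omega_iff_level_fun)
  have lin: "linear_form (\<lambda>v. phi_ord smul r v i)" for i
    using linear_form_of_rep[OF lex_rep_phi_ord(1)[OF l]] .
  have "phi_ord smul r v i = extend (phi smul b r) i v" for i v
    by (rule linear_form_eq_extend[OF lin]) (simp add: phi_def)
  then show ?thesis by (simp add: fun_eq_iff)
qed

lemma phi_regular:
  assumes "r \<in> N_omega smul F"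
  shows "phi smul b r \<in> regular" "lex_order (phi smul b r) = r"
proof -
  obtain l where l: "r \<in> X_space smul F" "level_fun r l" using assms by (auto simp: N_omega_iff_level_fun)
  let ?c = "\<lambda>i v. phi_ord smul r v i"
  note c = lex_rep_phi_ord[OF l]
  show "lex_order (phi smul b r) = r"
    unfolding lex_order_def extend_phi[OF assms] using less_iff_lex[OF c(1)] by auto
  have "\<exists>v. (\<forall>k<i. ?c k v = 0) \<and> ?c i v \<noteq> 0" for i
  proof -
    obtain v where v: "v \<noteq> 0" "l v = i" using l(2) unfolding level_fun_def by blast
    then have "lead ?c v = i" using c(2) by simp
    then show ?thesis using before_lead[of _ ?c v] at_lead[OF c(1) UNIV_I v(1)] by blast
  qed
  moreover have "\<exists>i. ?c i v \<noteq> 0" if "v \<noteq> 0" for v using at_lead[OF c(1) UNIV_I that] by blast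
  ultimately show "phi smul b r \<in> regular" by (simp add: regular_def extend_phi[OF assms])
qed

lemma bij_phi: "bij_betw (phi smul b) (N_omega smul F) regular"
  by (rule bij_betwI[of _ _ _ lex_order]) (auto simp: phi_regular lex_order_in_N_omega phi_lex_order)

section \<open>Automorphisms\<close>

lemma Aut_iff: "g \<in> Aut smul \<longleftrightarrow> (\<forall>u v. g (u + v) = g u + g v) \<and> (\<forall>c v. g (smul c v) = smul c (g v)) \<and> bij g"
  using vector_space_axioms by (auto simp: Aut_def Vector_Spaces.linear_iff)

lemma Aut_inv: 
  assumes "g \<in> Aut smul" shows "inv g \<in> Aut smul"
proof -
  have g: "g (u + v) = g u + g v" "g (smul c v) = smul c (g v)" "bij g" for u v c
    using assms by (auto simp: Aut_iff)
  have s: "g (inv g u) = u" and i: "inv g (g u) = u" for u 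
    using g(3) by (auto simp: bij_is_surj surj_f_inv_f bij_is_inj)
  have "inv g (u + v) = inv g u + inv g v" for u v
    using i[of "inv g u + inv g v"] by (simp add: g s)
  moreover have "inv g (smul c v) = smul c (inv g v)" for c v
    using i[of "smul c (inv g v)"] by (simp add: g s)
  ultimately show ?thesis using g(3) by (auto simp: Aut_iff bij_imp_bij_inv)
qed

lemma act_iff: 
  assumes "g \<in> Aut smul"
  shows "(u, v) \<in> act g r \<longleftrightarrow> (inv g u, inv g v) \<in> r" 
proof -
  have "bij g" using assms by (simp add: Aut_iff)
  then have s: "g (inv g u) = u" and i: "inv g (g u) = u" for u 
    by (auto simp: bij_is_surj surj_f_inv_f bij_is_inj)
  show ?thesis
  proof
    assume "(u, v) \<in> act g r" then show "(inv g u, inv g v) \<in> r" by (auto simp: act_def i)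
  next
    assume "(inv g u, inv g v) \<in> r"
    then show "(u, v) \<in> act g r" unfolding act_def by (force simp: s image_iff)
  qed
qed

lemma act_inv: 
  assumes "g \<in> Aut smul" 
  shows "act g (act (inv g) r) = r" "act (inv g) (act g r) = r"
proof -
  have "bij g" using assms by (simp add: Aut_iff)
  then have s: "g (inv g u) = u" and i: "inv g (g u) = u" for u 
    by (auto simp: bij_is_surj surj_f_inv_f bij_is_inj)
  show "act g (act (inv g) r) = r" "act (inv g) (act g r) = r"
    by (simp_all add: act_def image_image map_prod_def case_prod_beta s i)
qed

text \<open>
  Lexicographic representations are transported by precomposing the forms with \<open>g\<inverse>\<close>.
\<close>

lemma act_in_X_space:
  assumes g: "g \<in> Aut smul" and r: "r \<in> X_space smul F"
  shows "act g r \<in> X_space smul F"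
proof -
  have lin: "inv g (u + v) = inv g u + inv g v" "inv g (smul c v) = smul c (inv g v)" and bij: "bij (inv g)" for u v c
    using Aut_inv[OF g] by (auto simp: Aut_iff)
  have inj: "inv g u = inv g v \<longleftrightarrow> u = v" for u v using bij by (simp add: bij_is_inj inj_eq)
  have zero: "inv g 0 = 0" using lin(2)[of 0 0] by simp
  have s: "strict_linear_order_on UNIV r" using r by (simp add: X_space_def)
  have "strict_linear_order_on UNIV (act g r)"
    using s inj unfolding strict_linear_order_on_def trans_def irrefl_def total_on_def act_iff[OF g]
    by (metis UNIV_I)
  moreover have "natural_ordering smul F W (Restr (act g r) W)" if W: "findim_subspace smul W" for W
  proof -
    have sub: "subspace W" and fin: "finite W" using W by (auto simp: findim_subspace_iff)
    have sub': "subspace (inv g ` W)" unfolding subspace_def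
      using sub zero lin by (auto simp: subspace_def image_iff) metis+
    obtain x where x: "lex_rep r (span (inv g ` W)) x" using lex_rep_exists[OF r, of "inv g ` W"] fin by auto
    have sp: "span (inv g ` W) = inv g ` W" using sub' span_eq_iff by blast
    have x: "lex_rep r (inv g ` W) x" using x unfolding sp .
    have "lex_rep (act g r) W (\<lambda>i v. x i (inv g v))"
      unfolding lex_rep_def
    proof (intro conjI allI ballI impI)
      show "linear_form (\<lambda>v. x i (inv g v))" for i by (simp add: linear_form_def lin lex_rep_linear[OF x])
      show "\<exists>i. x i (inv g v) \<noteq> 0" if "v \<in> W" "v \<noteq> 0" for v
        using at_lead[OF x, of "inv g v"] that inj[of v 0] zero by auto
      show "(u, v) \<in> act g r \<longleftrightarrow> lex_less (\<lambda>i v. x i (inv g v)) u v" if "u \<in> W" "v \<in> W" for u v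
        unfolding act_iff[OF g] using less_iff_lex[OF x, of "inv g u" "inv g v"] that by (simp add: lex_less_def)
    qed (fact sub)
    then show ?thesis using natural_ordering_if_lex_rep fin by blast
  qed
  ultimately show ?thesis by (simp add: X_space_def)
qed

text \<open>
  The matrix of the forms precomposed with \<open>g\<close>. By \<open>lex_order_twist\<close> this corresponds to the
  action of \<open>g\<inverse>\<close> on orderings.
\<close>

definition twist :: "('v \<Rightarrow> 'v) \<Rightarrow> (nat \<Rightarrow> nat \<Rightarrow> 'f) \<Rightarrow> nat \<Rightarrow> nat \<Rightarrow> 'f" where
  "twist g M = (\<lambda>j i. extend M i (g (b j)))"

lemma extend_twist: 
  assumes "g \<in> Aut smul" shows "extend (twist g M) i v = extend M i (g v)"
proof -
  have "linear_form (\<lambda>v. extend M i (g v))"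
    using assms by (simp add: linear_form_def Aut_iff linear_form_simps[OF linear_form_extend])
  then have "extend M i (g v) = extend (twist g M) i v"
    by (rule linear_form_eq_extend) (simp add: twist_def)
  then show ?thesis ..
qed

lemma twist_inv:
  assumes "g \<in> Aut smul" shows "twist g (twist (inv g) M) = M" 
proof -
  have "bij g" using assms by (simp add: Aut_iff)
  then have "inv g (g u) = u" for u by (auto simp: bij_is_inj)
  then show ?thesis unfolding twist_def[of g] by (simp add: extend_twist[OF Aut_inv[OF assms]] fun_eq_iff)
qed

lemma lex_order_twist:
  assumes "g \<in> Aut smul" shows "act g (lex_order (twist g M)) = lex_order M"
proof -
  have "bij g" using assms by (simp add: Aut_iff)
  then have "g (inv g u) = u" for u by (auto simp: bij_is_surj surj_f_inv_f)
  then have "(u, v) \<in> act g (lex_order (twist g M)) \<longleftrightarrow> (u, v) \<in> lex_order M" for u v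
    unfolding act_iff[OF assms] by (simp add: lex_order_def lex_less_def extend_twist[OF assms])
  then show ?thesis by (intro set_eqI) (simp add: split_paired_all)
qed

lemma regular_twist:
  assumes "g \<in> Aut smul" shows "twist g M \<in> regular \<longleftrightarrow> M \<in> regular"
proof -
  have *: "twist g M \<in> regular" if g: "g \<in> Aut smul" and M: "M \<in> regular" for g M
  proof -
    have b: "bij g" and lin: "g (smul c v) = smul c (g v)" for c v using g by (auto simp: Aut_iff)
    have g0: "g v = 0 \<longleftrightarrow> v = 0" for v using b lin[of 0 0] by (metis bij_is_inj inj_eq scale_zero_left)
    have "\<exists>v. (\<forall>k<i. extend M k (g v) = 0) \<and> extend M i (g v) \<noteq> 0" for i
    proof -
      obtain v where v: "(\<forall>k<i. extend M k v = 0) \<and> extend M i v \<noteq> 0" using M unfolding regular_def by blast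
      have "g (inv g v) = v" using b by (simp add: bij_is_surj surj_f_inv_f)
      then show ?thesis using v by (intro exI[of _ "inv g v"]) simp
    qed
    moreover have "\<exists>i. extend M i (g v) \<noteq> 0" if "v \<noteq> 0" for v using M g0[of v] that by (simp add: regular_def)
    ultimately show ?thesis by (simp add: regular_def extend_twist[OF g])
  qed
  have "inv (inv g) = g" using assms by (simp add: Aut_iff inv_inv_eq)
  then have "twist (inv g) (twist g M) = M" using twist_inv[OF Aut_inv[OF assms], of M] by simp
  then show ?thesis using *[OF assms, of M] *[OF Aut_inv[OF assms], of "twist g M"] by auto
qed

definition flag :: "nat \<Rightarrow> 'v set" where
  "flag n = span (b ` {..<n})"

lemma finite_flag: "finite (flag n)" and subspace_flag: "subspace (flag n)"
  by (simp_all add: flag_def finite_span subspace_span)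

lemma findim_flag: "findim_subspace smul (flag n)"
  by (simp add: findim_subspace_iff finite_flag subspace_flag)

lemma flag_mono: "m \<le> n \<Longrightarrow> flag m \<subseteq> flag n"
  unfolding flag_def by (intro span_mono) auto

lemma flag_cover: "\<exists>n. v \<in> flag n"
proof -
  obtain n where n: "{j. coeffs v j \<noteq> 0} \<subseteq> {..<n}" using finite_coeffs[of v] finite_nat_bounded by blast
  have "(\<Sum>j<n. smul (coeffs v j) (b j)) \<in> flag n"
    unfolding flag_def by (intro span_sum span_scale span_base) auto
  then show ?thesis using coeffs_expand[OF _ n] by auto
qed

lemma finite_subset_flag: 
  assumes "finite S" shows "\<exists>n. S \<subseteq> flag n"
  using assms
proof (induction S)
  case (insert v S)
  then obtain m n where "S \<subseteq> flag m" "v \<in> flag n" using flag_cover by blast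
  then have "insert v S \<subseteq> flag (max m n)"
    using flag_mono[of m "max m n"] flag_mono[of n "max m n"] by auto
  then show ?case by blast
qed simp

lemma countable_space: "countable (UNIV :: 'v set)"
proof -
  have "UNIV = (\<Union>n. flag n)" using flag_cover by auto
  then show ?thesis using finite_flag by (metis countable_UN countable_finite countableI_type)
qed

text \<open>
  Let \<open>bs\<close> and \<open>bs'\<close> be the bases of the finite-dimensional subspace that induce the two orderings.
  The automorphism maps \<open>bs\<close> to \<open>bs'\<close> and fixes a complement of the subspace pointwise.
\<close>

lemma transitive_on_flag:
  assumes r: "r \<in> X_space smul F" and r': "r' \<in> X_space smul F"
  shows "\<exists>g\<in>Aut smul. \<forall>u\<in>flag n. inv g u \<in> flag n \<and> 
     (\<forall>v\<in>flag n. (inv g u, inv g v) \<in> r \<longleftrightarrow> (u, v) \<in> r')"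
proof -
  have "natural_ordering smul F (flag n) (Restr r (flag n))" "natural_ordering smul F (flag n) (Restr r' (flag n))"
    using r r' findim_flag by (auto simp: X_space_def)
  then obtain bs bs' where bs: "distinct bs" "independent (set bs)" "span (set bs) = flag n"
      "Restr r (flag n) = induced_ordering smul F bs"
    and bs': "distinct bs'" "independent (set bs')" "span (set bs') = flag n"
      "Restr r' (flag n) = induced_ordering smul F bs'"
    unfolding natural_ordering_def by metis
  have len: "length bs' = length bs"
    using dim_span_eq_card_independent[OF bs(2)] dim_span_eq_card_independent[OF bs'(2)] bs bs'
    by (simp add: distinct_card)
  define x where "x = coord bs" 
  define y where "y = coord bs'"
  define L where "L = lincomb smul bs"
  define L' where "L' = lincomb smul bs'"
  note x = linear_form_simps[OF linear_form_coord[OF bs(1,2)], folded x_def]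
  note y = linear_form_simps[OF linear_form_coord[OF bs'(1,2)], folded y_def]
  have xL: "i < length bs \<Longrightarrow> x i (L f) = f i" for i f using coord_lincomb[OF bs(1,2)] by (simp add: x_def L_def)
  have yL: "i < length bs \<Longrightarrow> y i (L' f) = f i" for i f using coord_lincomb[OF bs'(1,2)] len by (simp add: y_def L'_def)
  have Lx: "v \<in> flag n \<Longrightarrow> L (\<lambda>i. x i v) = v" for v using lincomb_coord[OF bs(1,2)] bs(3) by (simp add: x_def L_def)
  have Ly: "v \<in> flag n \<Longrightarrow> L' (\<lambda>i. y i v) = v" for v using lincomb_coord[OF bs'(1,2)] bs'(3) by (simp add: y_def L'_def)
  have L_in: "L f \<in> flag n" "L' f \<in> flag n" for f 
    using lincomb_in_span[OF bs(1,2)] lincomb_in_span[OF bs'(1,2)] bs(3) bs'(3) by (auto simp: L_def L'_def)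
  have L_cong: "L f = L f'" "L' f = L' f'" if "\<And>i. i < length bs \<Longrightarrow> f i = f' i" for f f'
    using that len by (auto simp: L_def L'_def lincomb_def)
  have L_add: "L (\<lambda>i. f i + f' i) = L f + L f'" "L' (\<lambda>i. f i + f' i) = L' f + L' f'" for f f'
    by (simp_all add: L_def L'_def lincomb_def scale_left_distrib sum.distrib)
  have L_scale: "L (\<lambda>i. c * f i) = smul c (L f)" "L' (\<lambda>i. c * f i) = smul c (L' f)" for c f
    by (simp_all add: L_def L'_def lincomb_def scale_sum_right)
  \<comment> \<open>p is the projection to the subspace along the common kernel of the coordinates x;
    g replaces bs by bs' in the image of p, and h reverses this.\<close>
  define p where "p v = L (\<lambda>i. x i v)" for v
  define g where "g v = v - p v + L' (\<lambda>i. x i v)" for v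
  define h where "h v = v - p v + L (\<lambda>i. y i (p v))" for v
  have xp: "x i (p v) = x i v" if "i < length bs" for i v using xL[OF that] by (simp add: p_def)
  have p_in: "p v \<in> flag n" for v using L_in by (simp add: p_def)
  have xh: "x i (h v) = y i (p v)" if "i < length bs" for i v
    using that by (simp add: h_def x xp xL)
  have xg: "x i (g v) = x i (L' (\<lambda>i. x i v))" if "i < length bs" for i v
    using that by (simp add: g_def x xp)
  have "g (h v) = v" for v
  proof -
    have "p (h v) = L (\<lambda>i. y i (p v))" "L' (\<lambda>i. x i (h v)) = L' (\<lambda>i. y i (p v))"
      unfolding p_def[of "h v"] by (intro L_cong xh; simp)+
    then show ?thesis using Ly[OF p_in] by (simp add: g_def) (simp add: h_def)
  qed
  moreover have "h (g v) = v" for v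
  proof -
    have "p (g v) = L (\<lambda>i. x i (L' (\<lambda>i. x i v)))" unfolding p_def[of "g v"] by (intro L_cong xg)
    then have pg: "p (g v) = L' (\<lambda>i. x i v)" using Lx[OF L_in(2)] by simp
    have "L (\<lambda>i. y i (p (g v))) = p v" unfolding pg p_def[of v] by (intro L_cong yL)
    then have "h (g v) = g v - L' (\<lambda>i. x i v) + p v" by (simp only: h_def[of "g v"] pg)
    then show ?thesis by (simp add: g_def)
  qed
  ultimately have bij: "bij g" and inv: "inv g = h"
    by (auto intro!: o_bij[of h] inv_equality)
  have "g (u + v) = g u + g v" "g (smul c v) = smul c (g v)" for u v c
    by (simp_all add: g_def p_def x L_add L_scale scale_right_distrib scale_right_diff_distrib algebra_simps)
  then have "g \<in> Aut smul" using bij by (simp add: Aut_iff)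
  moreover have "h u \<in> flag n \<and> (\<forall>v\<in>flag n. (h u, h v) \<in> r \<longleftrightarrow> (u, v) \<in> r')" if u: "u \<in> flag n" for u
  proof -
    have ph: "p v = v" if "v \<in> flag n" for v using Lx[OF that] by (simp add: p_def)
    have h_in: "h v \<in> flag n" if "v \<in> flag n" for v using ph[OF that] L_in by (simp add: h_def)
    have xy: "x i (h v) = y i v" if "v \<in> flag n" for v i
      using xh[of i v] ph[OF that] len by (cases "i < length bs") (auto simp: x_def y_def coord_def)
    have "(h u, h v) \<in> r \<longleftrightarrow> (u, v) \<in> r'" if v: "v \<in> flag n" for v
    proof -
      have "(h u, h v) \<in> r \<longleftrightarrow> (h u, h v) \<in> Restr r (flag n)" using h_in u v by simp
      also have "\<dots> \<longleftrightarrow> lex_less x (h u) (h v)" 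
        unfolding bs(4) induced_ordering_iff[OF bs(1,2)] bs(3) using h_in u v by (simp add: x_def)
      also have "\<dots> \<longleftrightarrow> lex_less y u v" by (simp add: lex_less_def xy u v)
      also have "\<dots> \<longleftrightarrow> (u, v) \<in> Restr r' (flag n)"
        unfolding bs'(4) induced_ordering_iff[OF bs'(1,2)] bs'(3) using u v by (simp add: y_def)
      finally show ?thesis using u v by simp
    qed
    then show ?thesis using h_in u by blast
  qed
  ultimately show ?thesis using inv by auto
qed

end

section \<open>Probability measures that are constant on nested partitions\<close>

lemma equal_measure_of_partition:
  assumes P: "prob_space P" and fin: "finite \<A>" and sub: "\<A> \<subseteq> sets P" and disj: "disjoint \<A>"
    and cover: "\<Union>\<A> = space P" and eq: "\<And>A B. A \<in> \<A> \<Longrightarrow> B \<in> \<A> \<Longrightarrow> emeasure P A = emeasure P B"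
    and A: "A \<in> \<A>"
  shows "emeasure P A = ennreal (1 / card \<A>)"
proof -
  interpret P: prob_space P by fact
  have meq: "measure P B = measure P A" if "B \<in> \<A>" for B using eq[OF that A] by (simp add: measure_def)
  have "1 = measure P (\<Union>B\<in>\<A>. B)" using cover P.prob_space by simp
  also have "\<dots> = (\<Sum>B\<in>\<A>. measure P B)"
    using fin sub disj by (intro P.finite_measure_finite_Union) (auto simp: disjoint_family_on_def disjoint_def)
  also have "\<dots> = card \<A> * measure P A" using meq by simp
  finally have "measure P A = 1 / card \<A>" by (metis mult_zero_left nonzero_eq_divide_eq mult.commute zero_neq_one)
  then show ?thesis by (simp add: P.emeasure_eq_measure)
qed

text \<open>
  A probability measure that is constant on a finite partition gives mass \<open>1 / n\<close> to each of the \<open>n\<close>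
  pieces. Nested partitions form an intersection-stable generator, so these values determine the measure.
\<close>

lemma prob_eqI_nested_partitions:
  fixes \<A> :: "nat \<Rightarrow> 'a set set"
  assumes P: "prob_space P" and Q: "prob_space Q"
    and sets_P: "sets P = sigma_sets \<Omega> (\<Union>n. \<A> n)" and sets_Q: "sets Q = sigma_sets \<Omega> (\<Union>n. \<A> n)"
    and fin: "\<And>n. finite (\<A> n)" and cover: "\<And>n. \<Union>(\<A> n) = \<Omega>"
    and nested: "\<And>m n A B. m \<le> n \<Longrightarrow> A \<in> \<A> m \<Longrightarrow> B \<in> \<A> n \<Longrightarrow> B \<subseteq> A \<or> A \<inter> B = {}"
    and eq_P: "\<And>n A B. A \<in> \<A> n \<Longrightarrow> B \<in> \<A> n \<Longrightarrow> emeasure P A = emeasure P B"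
    and eq_Q: "\<And>n A B. A \<in> \<A> n \<Longrightarrow> B \<in> \<A> n \<Longrightarrow> emeasure Q A = emeasure Q B"
  shows "P = Q"
proof -
  interpret P: prob_space P by fact
  interpret Q: prob_space Q by fact
  define E where "E = insert {} (insert \<Omega> (\<Union>n. \<A> n))"
  have Pow: "(\<Union>n. \<A> n) \<subseteq> Pow \<Omega>" using cover by blast
  then have "E \<subseteq> Pow \<Omega>" by (auto simp: E_def)
  have space: "space P = \<Omega>" "space Q = \<Omega>"
    using sets_eq_imp_space_eq[of P "sigma \<Omega> (\<Union>n. \<A> n)"] sets_eq_imp_space_eq[of Q "sigma \<Omega> (\<Union>n. \<A> n)"]
      Pow sets_P sets_Q by simp_all
  have disj: "disjoint (\<A> n)" for n
    unfolding disjoint_def using nested[of n n] by blast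
  have "sigma_sets \<Omega> E = sigma_sets \<Omega> (\<Union>n. \<A> n)"
  proof (rule sigma_sets_eqI)
    fix A assume "A \<in> E" then show "A \<in> sigma_sets \<Omega> (\<Union>n. \<A> n)"
      unfolding E_def using sigma_sets_top sigma_sets.Empty by (auto intro: sigma_sets.Basic)
  qed (auto simp: E_def)
  then have sets: "sets P = sigma_sets \<Omega> E" "sets Q = sigma_sets \<Omega> E" using sets_P sets_Q by simp_all
  have eq: "emeasure P A = emeasure Q A" if AE: "A \<in> E" for A
  proof -
    consider "A = {}" | "A = \<Omega>" | n where "A \<in> \<A> n" using AE unfolding E_def by blast
    then show ?thesis
    proof cases
      case 2 then show ?thesis using P.emeasure_space_1 Q.emeasure_space_1 space by simp
    next
      case (3 n)
      have "\<A> n \<subseteq> sets P" "\<A> n \<subseteq> sets Q" using sets_P sets_Q by auto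
      then show ?thesis
        using equal_measure_of_partition[OF P fin _ disj _ eq_P 3] 
          equal_measure_of_partition[OF Q fin _ disj _ eq_Q 3] cover space by simp
    qed simp
  qed
  have int: "A \<inter> B \<in> E" if AB: "A \<in> \<A> m" "B \<in> \<A> n" for A B m n
  proof -
    consider "A \<inter> B = {}" | "A \<inter> B = A" | "A \<inter> B = B"
      using nested[of m n A B] nested[of n m B A] AB by (cases "m \<le> n") auto
    then show ?thesis using AB by cases (auto simp: E_def)
  qed
  have "Int_stable E"
  proof (rule Int_stableI)
    fix A B assume AB: "A \<in> E" "B \<in> E"
    then have "A \<subseteq> \<Omega>" "B \<subseteq> \<Omega>" using \<open>E \<subseteq> Pow \<Omega>\<close> by auto
    then have "\<Omega> \<inter> B = B" "A \<inter> \<Omega> = A" by auto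
    consider "A = {} \<or> B = {}" | "A = \<Omega>" | "B = \<Omega>" | m n where "A \<in> \<A> m" "B \<in> \<A> n"
      using AB unfolding E_def by blast
    then show "A \<inter> B \<in> E"
    proof cases
      case 1 then show ?thesis by (auto simp: E_def)
    qed (use AB int \<open>\<Omega> \<inter> B = B\<close> \<open>A \<inter> \<Omega> = A\<close> in simp_all)
  qed
  then show ?thesis
    using \<open>E \<subseteq> Pow \<Omega>\<close> eq sets
    by (rule measure_eqI_generator_eq[where A="\<lambda>_. \<Omega>"]) (auto simp: E_def space[symmetric] P.emeasure_space_1)
qed

text \<open>
  It suffices to check boxes, whose preimages are boxes with sides of the same measure.
\<close>

lemma distr_PiM_componentwise:
  fixes M :: "'i \<Rightarrow> 'a measure"
  assumes prob: "\<And>i. prob_space (M i)" and t: "\<And>i. t i \<in> M i \<rightarrow>\<^sub>M M i"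
    and inv: "\<And>i. distr (M i) (M i) (t i) = M i"
  shows "distr (PiM UNIV M) (PiM UNIV M) (\<lambda>x i. t i (x i)) = PiM UNIV M"
proof -
  interpret product_prob_space M UNIV
    by (intro product_prob_spaceI prob)
  note t[measurable]
  have meas[measurable]: "(\<lambda>x i. t i (x i)) \<in> PiM UNIV M \<rightarrow>\<^sub>M PiM UNIV M"
    by (rule measurable_PiM_single') (auto simp: space_PiM PiE_iff intro: measurable_space[OF t])
  show ?thesis
  proof (rule PiM_eq)
    fix J F assume J: "finite J" "J \<subseteq> UNIV" and F: "\<And>j. j \<in> J \<Longrightarrow> F j \<in> sets (M j)"
    have "(\<lambda>x i. t i (x i)) -` prod_emb UNIV M J (Pi\<^sub>E J F) \<inter> space (PiM UNIV M) =
      {x \<in> space (PiM UNIV M). \<forall>j\<in>J. x j \<in> t j -` F j \<inter> space (M j)}"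
      by (auto simp: prod_emb_def space_PiM PiE_iff intro: measurable_space[OF t])
    then have "emeasure (distr (PiM UNIV M) (PiM UNIV M) (\<lambda>x i. t i (x i))) (prod_emb UNIV M J (Pi\<^sub>E J F)) =
      emeasure (PiM UNIV M) {x \<in> space (PiM UNIV M). \<forall>j\<in>J. x j \<in> t j -` F j \<inter> space (M j)}"
      using J F by (subst emeasure_distr) (auto intro!: sets_PiM_I)
    also have "\<dots> = (\<Prod>j\<in>J. emeasure (M j) (t j -` F j \<inter> space (M j)))"
      using J F t by (intro emeasure_PiM_Collect) (auto intro: measurable_sets)
    also have "\<dots> = (\<Prod>j\<in>J. emeasure (M j) (F j))"
    proof (rule prod.cong[OF refl])
      fix j assume "j \<in> J"
      then show "emeasure (M j) (t j -` F j \<inter> space (M j)) = emeasure (M j) (F j)"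
        using emeasure_distr[OF t[of j] F] inv[of j] by simp
    qed
    finally show "emeasure (distr (PiM UNIV M) (PiM UNIV M) (\<lambda>x i. t i (x i))) (prod_emb UNIV M J (Pi\<^sub>E J F)) =
      (\<Prod>j\<in>J. emeasure (M j) (F j))" .
  qed simp
qed

lemma (in prob_space) infinitely_many_equal_disjoint_null:
  fixes A :: "nat \<Rightarrow> 'a set"
  assumes "range A \<subseteq> events" "disjoint_family A" "\<And>n. prob (A n) = c"
  shows "c = 0"
proof -
  have "(\<lambda>n. prob (A n)) sums prob (\<Union>n. A n)" using assms by (intro finite_measure_UNION) auto
  then have "summable (\<lambda>n::nat. c)" using assms(3) sums_summable by simp
  then show ?thesis by (simp add: summable_const_iff)
qed

lemma measurable_count_space_finite:
  fixes f :: "'a \<Rightarrow> 'b::finite"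
  assumes "\<And>a. {x \<in> space N. f x = a} \<in> sets N"
  shows "f \<in> N \<rightarrow>\<^sub>M count_space UNIV"
proof -
  have "f -` {a} \<inter> space N = {x \<in> space N. f x = a}" for a by auto
  then show ?thesis using assms by (simp add: measurable_count_space_eq2)
qed

lemma measurable_count_space_binary:
  fixes h :: "'b::countable \<Rightarrow> 'c \<Rightarrow> 'd"
  assumes f: "f \<in> N \<rightarrow>\<^sub>M count_space UNIV" and g: "g \<in> N \<rightarrow>\<^sub>M count_space UNIV"
  shows "(\<lambda>x. h (f x) (g x)) \<in> N \<rightarrow>\<^sub>M count_space UNIV"
proof (rule measurable_compose_countable[OF _ f])
  show "(\<lambda>x. h i (g x)) \<in> N \<rightarrow>\<^sub>M count_space UNIV" for i
    by (rule measurable_compose[OF g]) simp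
qed

section \<open>The uniform measure on matrices\<close>

abbreviation uniform_sequence :: "(nat \<Rightarrow> 'f::{field,finite}) measure" where
  "uniform_sequence \<equiv> PiM UNIV (\<lambda>_. uniform_count_measure UNIV)"

lemma prob_space_uniform: "prob_space (uniform_count_measure (UNIV :: 'f::{field,finite} set))"
  by (rule prob_space_uniform_count_measure) auto

lemma prob_space_uniform_sequence: "prob_space (uniform_sequence :: (nat \<Rightarrow> 'f::{field,finite}) measure)"
  by (intro prob_space_PiM prob_space_uniform)

lemma prob_space_sigma_prod: "prob_space (sigma_prod :: (nat \<Rightarrow> nat \<Rightarrow> 'f::{field,finite}) measure)"
  unfolding sigma_prod_def by (intro prob_space_PiM prob_space_uniform_sequence)

lemma space_uniform_sequence [simp]: "space (uniform_sequence :: (nat \<Rightarrow> 'f::{field,finite}) measure) = UNIV"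
  by (auto simp: space_PiM space_uniform_count_measure PiE_iff)

lemma space_sigma_prod [simp]: "space (sigma_prod :: (nat \<Rightarrow> nat \<Rightarrow> 'f::{field,finite}) measure) = UNIV"
  by (auto simp: sigma_prod_def space_PiM[of _ "\<lambda>_. uniform_sequence"] PiE_iff)

lemma measurable_entry [measurable]:
  "(\<lambda>M. M j i) \<in> (sigma_prod :: (nat \<Rightarrow> nat \<Rightarrow> 'f::{field,finite}) measure) \<rightarrow>\<^sub>M count_space UNIV"
proof -
  have "(\<lambda>M. M j) \<in> sigma_prod \<rightarrow>\<^sub>M uniform_sequence" unfolding sigma_prod_def by simp
  moreover have "(\<lambda>x. x i) \<in> (uniform_sequence :: (nat \<Rightarrow> 'f) measure) \<rightarrow>\<^sub>M uniform_count_measure UNIV" by simp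
  then have "(\<lambda>x. x i) \<in> (uniform_sequence :: (nat \<Rightarrow> 'f) measure) \<rightarrow>\<^sub>M count_space UNIV"
    by (simp cong: measurable_cong_sets add: sets_uniform_count_measure_count_space)
  ultimately show ?thesis by (rule measurable_compose)
qed

lemma measurable_sigma_prodI:
  fixes f :: "'a \<Rightarrow> nat \<Rightarrow> nat \<Rightarrow> 'f::{field,finite}"
  assumes "\<And>j i. (\<lambda>x. f x j i) \<in> N \<rightarrow>\<^sub>M count_space UNIV"
  shows "f \<in> N \<rightarrow>\<^sub>M sigma_prod"
proof -
  have "(\<lambda>x. f x j i) \<in> N \<rightarrow>\<^sub>M uniform_count_measure UNIV" for j i
    using assms[of j i] by (simp cong: measurable_cong_sets add: sets_uniform_count_measure_count_space)
  then have "(\<lambda>x i. f x j i) \<in> N \<rightarrow>\<^sub>M uniform_sequence" for j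
    by (intro measurable_PiM_single') (auto simp: space_uniform_count_measure)
  then have "(\<lambda>x j. f x j) \<in> N \<rightarrow>\<^sub>M sigma_prod" unfolding sigma_prod_def
    by (intro measurable_PiM_single') (auto simp: space_uniform_count_measure PiE_iff)
  then show ?thesis by simp
qed

definition cylinder :: "nat \<Rightarrow> (nat \<Rightarrow> nat \<Rightarrow> 'f) \<Rightarrow> (nat \<Rightarrow> nat \<Rightarrow> 'f) set" where
  "cylinder n A = {M. \<forall>j<n. \<forall>i<n. M j i = A j i}"

lemma cylinder_sets: "cylinder n A \<in> sets (sigma_prod :: (nat \<Rightarrow> nat \<Rightarrow> 'f::{field,finite}) measure)"
proof -
  have "{M \<in> space (sigma_prod :: (nat \<Rightarrow> nat \<Rightarrow> 'f) measure). \<forall>j<n. \<forall>i<n. M j i = A j i} \<in> sets sigma_prod"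
    by measurable
  then show ?thesis by (simp add: cylinder_def)
qed

lemma finite_cylinders: "finite (range (cylinder n :: _ \<Rightarrow> (nat \<Rightarrow> nat \<Rightarrow> 'f::finite) set))"
proof -
  have "cylinder n A \<in> (\<lambda>f. {M. \<forall>j<n. \<forall>i<n. M j i = f (j, i)}) ` (({..<n} \<times> {..<n}) \<rightarrow>\<^sub>E UNIV)" 
    for A :: "nat \<Rightarrow> nat \<Rightarrow> 'f"
    by (rule image_eqI[of _ _ "restrict (\<lambda>(j, i). A j i) ({..<n} \<times> {..<n})"]) (auto simp: cylinder_def)
  then have "range (cylinder n) \<subseteq> (\<lambda>f. {M :: nat \<Rightarrow> nat \<Rightarrow> 'f. \<forall>j<n. \<forall>i<n. M j i = f (j, i)}) ` 
     (({..<n} \<times> {..<n}) \<rightarrow>\<^sub>E UNIV)" by blast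
  moreover have "finite ((({..<n} \<times> {..<n}) \<rightarrow>\<^sub>E (UNIV :: 'f set)))" by (intro finite_PiE) auto
  ultimately show ?thesis by (meson finite_imageI finite_subset)
qed

lemma sets_sigma_prod_cylinders: 
  "sets (sigma_prod :: (nat \<Rightarrow> nat \<Rightarrow> 'f::{field,finite}) measure) = sigma_sets UNIV (\<Union>n. range (cylinder n))"
proof
  show "sigma_sets UNIV (\<Union>n. range (cylinder n)) \<subseteq> sets (sigma_prod :: (nat \<Rightarrow> nat \<Rightarrow> 'f) measure)"
    using sets.sigma_sets_subset[of "\<Union>n. range (cylinder n)" "sigma_prod :: (nat \<Rightarrow> nat \<Rightarrow> 'f) measure"] cylinder_sets
    by auto
  let ?N = "sigma UNIV (\<Union>n. range (cylinder n)) :: (nat \<Rightarrow> nat \<Rightarrow> 'f) measure"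
  have sN: "space ?N = UNIV" "sets ?N = sigma_sets UNIV (\<Union>n. range (cylinder n))" by simp_all
  have "(\<lambda>M. M) \<in> ?N \<rightarrow>\<^sub>M sigma_prod"
  proof (intro measurable_sigma_prodI measurable_count_space_finite)
    fix j i and a :: 'f
    let ?n = "Suc (max j i)"
    have "{M. M j i = a} = \<Union>{C \<in> range (cylinder ?n). C \<subseteq> {M. M j i = a}}"
    proof (intro equalityI subsetI)
      fix M assume M: "M \<in> {M. M j i = a}"
      have "M \<in> cylinder ?n M" "cylinder ?n M \<subseteq> {M. M j i = a}" using M by (auto simp: cylinder_def)
      then show "M \<in> \<Union>{C \<in> range (cylinder ?n). C \<subseteq> {M. M j i = a}}" by blast
    qed auto
    also have "\<dots> \<in> sets ?N"
    proof (rule sets.finite_Union)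
      show "finite {C \<in> range (cylinder ?n). C \<subseteq> {M. M j i = a}}" 
        by (rule finite_subset[OF _ finite_cylinders[of ?n]]) auto
      show "{C \<in> range (cylinder ?n). C \<subseteq> {M. M j i = a}} \<subseteq> sets ?N" 
        unfolding sN by (auto intro!: sigma_sets.Basic)
    qed
    finally show "{M \<in> space ?N. M j i = a} \<in> sets ?N" by (simp add: sN)
  qed
  then have "(\<lambda>M. M) -` A \<inter> space ?N \<in> sets ?N" if "A \<in> sets sigma_prod" for A
    using measurable_sets that by blast
  then show "sets (sigma_prod :: (nat \<Rightarrow> nat \<Rightarrow> 'f) measure) \<subseteq> sigma_sets UNIV (\<Union>n. range (cylinder n))"
    unfolding sN by auto
qed

text \<open>
  Translation acts entrywise, and on a single entry it permutes the scalars.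
\<close>

lemma translate_sigma_prod:
  fixes A :: "nat \<Rightarrow> nat \<Rightarrow> 'f::{field,finite}"
  shows "distr sigma_prod sigma_prod (\<lambda>M j i. M j i + A j i) = sigma_prod"
proof -
  have base: "distr (uniform_count_measure UNIV) (uniform_count_measure UNIV) (\<lambda>x. x + a) = uniform_count_measure UNIV" 
    for a :: 'f
  proof (rule measure_eqI)
    fix X assume "X \<in> sets (distr (uniform_count_measure UNIV) (uniform_count_measure UNIV) (\<lambda>x. x + a))"
    have "card ((\<lambda>x. x + a) -` X) = card X" 
      by (rule card_vimage_inj) (auto simp: inj_def image_iff intro: exI[of _ "_ - a"])
    then show "emeasure (distr (uniform_count_measure UNIV) (uniform_count_measure UNIV) (\<lambda>x. x + a)) X =
       emeasure (uniform_count_measure UNIV) X"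
      by (subst emeasure_distr) (simp_all add: sets_uniform_count_measure space_uniform_count_measure 
          emeasure_uniform_count_measure measurable_def)
  qed simp
  have m: "(\<lambda>x. x + a) \<in> uniform_count_measure UNIV \<rightarrow>\<^sub>M uniform_count_measure UNIV" for a :: 'f
    by (simp add: measurable_def space_uniform_count_measure sets_uniform_count_measure)
  have row: "distr uniform_sequence uniform_sequence (\<lambda>x i. x i + a i) = uniform_sequence" for a :: "nat \<Rightarrow> 'f"
    by (rule distr_PiM_componentwise[OF prob_space_uniform m base])
  have mrow: "(\<lambda>x i. x i + a i) \<in> uniform_sequence \<rightarrow>\<^sub>M uniform_sequence" for a :: "nat \<Rightarrow> 'f"
  proof (rule measurable_PiM_single')
    show "(\<lambda>x. x i + a i) \<in> uniform_sequence \<rightarrow>\<^sub>M uniform_count_measure UNIV" for i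
      by (rule measurable_compose[OF _ m[of "a i"], of "\<lambda>x. x i"]) simp
  qed (auto simp: space_uniform_count_measure)
  show ?thesis unfolding sigma_prod_def
    by (rule distr_PiM_componentwise[OF prob_space_uniform_sequence mrow row])
qed

lemma measurable_translate:
  fixes A :: "nat \<Rightarrow> nat \<Rightarrow> 'f::{field,finite}"
  shows "(\<lambda>M j i. M j i + A j i) \<in> sigma_prod \<rightarrow>\<^sub>M sigma_prod"
  by (intro measurable_sigma_prodI measurable_count_space_binary[of _ _ _ "(+)"]) auto

text \<open>
  Any two cylinders that constrain the same entries are translates of each other.
\<close>

lemma translation_invariant_unique:
  fixes Q :: "(nat \<Rightarrow> nat \<Rightarrow> 'f::{field,finite}) measure"
  assumes Q: "prob_space Q" "sets Q = sets sigma_prod"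
    and inv: "\<And>A. distr Q sigma_prod (\<lambda>M j i. M j i + A j i) = Q"
  shows "Q = sigma_prod"
proof (rule prob_eqI_nested_partitions[OF Q(1) prob_space_sigma_prod, of UNIV "\<lambda>n. range (cylinder n)"])
  show "sets Q = sigma_sets UNIV (\<Union>n. range (cylinder n))" using Q(2) sets_sigma_prod_cylinders by simp
  have eq: "emeasure R X = emeasure R Y" 
    if X: "X \<in> range (cylinder n)" "Y \<in> range (cylinder n)" and sets: "sets R = sets sigma_prod" and
      inv: "\<And>A. distr R sigma_prod (\<lambda>M j i. M j i + A j i) = R"
    for n X Y and R :: "(nat \<Rightarrow> nat \<Rightarrow> 'f) measure"
  proof -
    obtain A B where AB: "X = cylinder n A" "Y = cylinder n B" using X by auto
    let ?t = "\<lambda>M j i. M j i + (B j i - A j i)"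
    have space: "space R = UNIV" using sets_eq_imp_space_eq[OF sets] by simp
    have "?t -` Y = X" by (auto simp: AB cylinder_def)
    moreover have "emeasure (distr R sigma_prod ?t) Y = emeasure R (?t -` Y \<inter> space R)"
      using measurable_translate sets cylinder_sets AB 
      by (intro emeasure_distr) (auto cong: measurable_cong_sets)
    ultimately show ?thesis using inv[of "\<lambda>j i. B j i - A j i"] space by simp
  qed
  show "emeasure Q X = emeasure Q Y" if "X \<in> range (cylinder n)" "Y \<in> range (cylinder n)" for n X Y
    using eq[OF that Q(2) inv] .
  show "emeasure sigma_prod X = emeasure sigma_prod Y" 
    if "X \<in> range (cylinder n)" "Y \<in> range (cylinder n)" for n and X Y :: "(nat \<Rightarrow> nat \<Rightarrow> 'f) set"
    using eq[OF that refl translate_sigma_prod] .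
  show "B \<subseteq> A \<or> A \<inter> B = {}" if mn: "m \<le> n" "A \<in> range (cylinder m)" "B \<in> range (cylinder n)" 
    for m n and A B :: "(nat \<Rightarrow> nat \<Rightarrow> 'f) set"
  proof -
    obtain f g where AB: "A = cylinder m f" "B = cylinder n g" using mn by blast
    have "B \<subseteq> A" if ne: "A \<inter> B \<noteq> {}"
    proof -
      obtain M where "M \<in> A" "M \<in> B" using ne by blast
      then have "f j i = g j i" if "j < m" "i < m" for j i using that \<open>m \<le> n\<close> by (auto simp: AB cylinder_def)
      then show ?thesis using \<open>m \<le> n\<close> by (auto simp: AB cylinder_def)
    qed
    then show ?thesis by blast
  qed
  show "\<Union> (range (cylinder n)) = (UNIV :: (nat \<Rightarrow> nat \<Rightarrow> 'f) set)" for n 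
    by (auto simp: cylinder_def)
qed (use sets_sigma_prod_cylinders finite_cylinders in auto)

context ordered_basis begin

section \<open>The Borel sets of orderings\<close>

text \<open>
  The basic neighbourhoods of \<open>r\<close> given by the subspaces \<open>flag n\<close>; every finite-dimensional
  subspace lies in some \<open>flag n\<close>, so they form a neighbourhood base.
\<close>

definition cell :: "nat \<Rightarrow> 'v rel \<Rightarrow> 'v rel set" where
  "cell n r = basic_nbhd smul F (flag n) (Restr r (flag n))"

abbreviation X where "X \<equiv> X_space smul F"
abbreviation XB where "XB \<equiv> X_borel smul F"

lemma in_cell_iff: "r' \<in> cell n r \<longleftrightarrow> r' \<in> X \<and> (\<forall>u\<in>flag n. \<forall>v\<in>flag n. (u, v) \<in> r' \<longleftrightarrow> (u, v) \<in> r)"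
  unfolding cell_def basic_nbhd_def by (auto simp: set_eq_iff)

lemma cell_mono:
  assumes "m \<le> n" shows "cell n r \<subseteq> cell m r"
  using flag_mono[OF assms] by (auto simp: in_cell_iff subset_iff)

lemma finite_cells: "finite (cell n ` X)"
proof -
  have "cell n ` X \<subseteq> basic_nbhd smul F (flag n) ` Pow (flag n \<times> flag n)" by (auto simp: cell_def)
  moreover have "finite (Pow (flag n \<times> flag n))" using finite_flag by simp
  ultimately show ?thesis by (meson finite_imageI finite_subset)
qed

lemma openin_cell: "r \<in> X \<Longrightarrow> openin (X_topology smul F) (cell n r)"
  unfolding X_topology_def cell_def
  by (rule topology_generated_by_Basis) (use findim_flag in \<open>auto simp: X_space_def\<close>)

lemma openin_imp_cells:
  assumes "openin (X_topology smul F) U"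
  shows "U \<subseteq> X \<and> (\<forall>r\<in>U. \<exists>n. cell n r \<subseteq> U)"
proof -
  have "generate_topology_on {basic_nbhd smul F W s | W s. findim_subspace smul W \<and> natural_ordering smul F W s} U"
    using assms by (simp add: X_topology_def openin_topology_generated_by_iff)
  then show ?thesis
  proof induction
    case (Int U V)
    have "\<exists>n. cell n r \<subseteq> U \<inter> V" if r: "r \<in> U" "r \<in> V" for r
    proof -
      obtain m n where "cell m r \<subseteq> U" "cell n r \<subseteq> V" using Int r by blast
      then have "cell (max m n) r \<subseteq> U \<inter> V"
        using cell_mono[of m "max m n" r] cell_mono[of n "max m n" r] by auto
      then show ?thesis by blast
    qed
    then show ?case using Int by blast
  next
    case (UN K)
    have "\<exists>n. cell n r \<subseteq> \<Union>K" if r: "r \<in> U" "U \<in> K" for r U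
    proof -
      obtain n where "cell n r \<subseteq> U" using UN.IH[OF r(2)] r(1) by blast
      then show ?thesis using r by blast
    qed
    then show ?case using UN.IH by blast
  next
    case (Basis U)
    then obtain W s where W: "U = basic_nbhd smul F W s" "findim_subspace smul W" by blast
    then obtain n where n: "W \<subseteq> flag n" using finite_subset_flag findim_subspace_iff by blast
    have "r' \<in> U" if "r \<in> U" "r' \<in> cell n r" for r r'
    proof -
      have "Restr r' W = Restr r W" using that(2) n by (auto simp: in_cell_iff)
      then show ?thesis using that by (auto simp: W(1) basic_nbhd_def in_cell_iff)
    qed
    then have "cell n r \<subseteq> U" if "r \<in> U" for r using that by blast
    moreover have "U \<subseteq> X" by (auto simp: W(1) basic_nbhd_def)
    ultimately show ?case by blast
  qed simp
qed

lemma space_XB: "space XB = X" and sets_XB_open: "sets XB = sigma_sets X {U. openin (X_topology smul F) U}"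
proof -
  have "{U. openin (X_topology smul F) U} \<subseteq> Pow X" using openin_imp_cells by blast
  then show "space XB = X" "sets XB = sigma_sets X {U. openin (X_topology smul F) U}"
    by (simp_all add: X_borel_def)
qed

text \<open>
  For each \<open>n\<close> there are only finitely many cells, so every open set is a countable union of cells.
\<close>

lemma sets_XB_cells: "sets XB = sigma_sets X (\<Union>n. cell n ` X)"
  unfolding sets_XB_open
proof (rule sigma_sets_eqI)
  fix A assume "A \<in> (\<Union>n. cell n ` X)"
  then show "A \<in> sigma_sets X {U. openin (X_topology smul F) U}"
    using openin_cell by (auto intro: sigma_sets.Basic)
next
  fix U assume "U \<in> {U. openin (X_topology smul F) U}"
  then have U: "U \<subseteq> X" "\<And>r. r \<in> U \<Longrightarrow> \<exists>n. cell n r \<subseteq> U" using openin_imp_cells by auto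
  have "U = (\<Union>n. \<Union>{C \<in> cell n ` X. C \<subseteq> U})"
  proof (intro equalityI subsetI)
    fix r assume r: "r \<in> U"
    then obtain n where "cell n r \<subseteq> U" using U by blast
    moreover have "r \<in> cell n r" using r U by (auto simp: in_cell_iff)
    ultimately show "r \<in> (\<Union>n. \<Union>{C \<in> cell n ` X. C \<subseteq> U})" using r U by blast
  qed auto
  also have "\<dots> \<in> sigma_sets X (\<Union>n. cell n ` X)"
  proof (intro sigma_sets_UNION)
    show "countable (range (\<lambda>n. \<Union>{C \<in> cell n ` X. C \<subseteq> U}))" by simp
    fix B assume "B \<in> range (\<lambda>n. \<Union>{C \<in> cell n ` X. C \<subseteq> U})"
    then obtain n where B: "B = \<Union>{C \<in> cell n ` X. C \<subseteq> U}" by blast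
    show "B \<in> sigma_sets X (\<Union>n. cell n ` X)" unfolding B
    proof (rule sigma_sets_UNION)
      have "finite {C \<in> cell n ` X. C \<subseteq> U}" by (rule finite_subset[OF _ finite_cells[of n]]) auto
      then show "countable {C \<in> cell n ` X. C \<subseteq> U}" by (rule countable_finite)
    qed (auto intro: sigma_sets.Basic)
  qed
  finally show "U \<in> sigma_sets X (\<Union>n. cell n ` X)" .
qed

lemma cell_sets: "r \<in> X \<Longrightarrow> cell n r \<in> sets XB"
  unfolding sets_XB_cells by (auto intro: sigma_sets.Basic)

lemma pred_less [measurable]: "Measurable.pred XB (\<lambda>r. (u, v) \<in> r)"
proof -
  obtain n where n: "{u, v} \<subseteq> flag n" using finite_subset_flag[of "{u, v}"] by auto
  have "{r \<in> X. (u, v) \<in> r} = \<Union>{C \<in> cell n ` X. C \<subseteq> {r. (u, v) \<in> r}}"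
  proof (intro equalityI subsetI)
    fix r assume r: "r \<in> {r \<in> X. (u, v) \<in> r}"
    then have "r \<in> cell n r" "cell n r \<subseteq> {r. (u, v) \<in> r}" using n by (auto simp: in_cell_iff)
    then show "r \<in> \<Union>{C \<in> cell n ` X. C \<subseteq> {r. (u, v) \<in> r}}" using r by blast
  next
    have "cell n r \<subseteq> X" for r by (auto simp: in_cell_iff)
    then show "r \<in> {r \<in> X. (u, v) \<in> r}" if "r \<in> \<Union>{C \<in> cell n ` X. C \<subseteq> {r. (u, v) \<in> r}}" for r
      using that by blast
  qed
  also have "\<dots> \<in> sets XB"
  proof (rule sets.finite_Union)
    show "finite {C \<in> cell n ` X. C \<subseteq> {r. (u, v) \<in> r}}" by (rule finite_subset[OF _ finite_cells[of n]]) auto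
  qed (auto intro: cell_sets)
  finally show ?thesis by (simp add: pred_def space_XB)
qed

lemma measurable_XBI:
  assumes f: "f \<in> space N \<rightarrow> X" and less: "\<And>u v. {x \<in> space N. (u, v) \<in> f x} \<in> sets N"
  shows "f \<in> N \<rightarrow>\<^sub>M XB"
proof (rule measurable_sigma_sets[OF sets_XB_cells])
  show "(\<Union>n. cell n ` X) \<subseteq> Pow X" by (auto simp: in_cell_iff)
  show "f \<in> space N \<rightarrow> X" by fact
  fix A assume "A \<in> (\<Union>n. cell n ` X)"
  then obtain n r where A: "A = cell n r" by blast
  have fin: "finite (flag n \<times> flag n)" using finite_flag by simp
  have "0 \<in> flag n" using subspace_flag subspace_0 by blast
  then have ne: "flag n \<times> flag n \<noteq> {}" by blast
  have "f -` A \<inter> space N = {x \<in> space N. \<forall>p\<in>flag n \<times> flag n. p \<in> f x \<longleftrightarrow> p \<in> r}"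
    using f by (auto simp: A in_cell_iff)
  also have "\<dots> \<in> sets N"
  proof (rule sets.sets_Collect_finite_All'[OF _ fin ne])
    fix p assume "p \<in> flag n \<times> flag n"
    have "{x \<in> space N. p \<in> f x} \<in> sets N" using less[of "fst p" "snd p"] by simp
    then show "{x \<in> space N. p \<in> f x \<longleftrightarrow> p \<in> r} \<in> sets N"
      by (cases "p \<in> r") (simp_all add: sets.sets_Collect_neg)
  qed
  finally show "f -` A \<inter> space N \<in> sets N" .
qed

lemma pred_ex_vector:
  assumes "\<And>v::'v. Measurable.pred N (P v)" shows "Measurable.pred N (\<lambda>x. \<exists>v. P v x)"
proof -
  have s: "surj (from_nat_into (UNIV :: 'v set))"
    using countable_space by (simp add: range_from_nat_into)
  have "(\<exists>v. P v x) \<longleftrightarrow> (\<exists>n. P (from_nat_into UNIV n) x)" for x using s by (metis surjD)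
  then show ?thesis using assms by simp
qed

lemma pred_all_vector:
  assumes "\<And>v::'v. Measurable.pred N (P v)" shows "Measurable.pred N (\<lambda>x. \<forall>v. P v x)"
proof -
  have s: "surj (from_nat_into (UNIV :: 'v set))"
    using countable_space by (simp add: range_from_nat_into)
  have "(\<forall>v. P v x) \<longleftrightarrow> (\<forall>n. P (from_nat_into UNIV n) x)" for x using s by (metis surjD)
  then show ?thesis using assms by simp
qed

lemma pred_sim [measurable]: "Measurable.pred XB (\<lambda>r. (u, v) \<in> sim_rel smul r)"
proof -
  have [measurable]: "Measurable.pred XB (\<lambda>r. much_less smul r u v)" for u v
    unfolding much_less_def by measurable
  have "(u, v) \<in> sim_rel smul r \<longleftrightarrow> u \<noteq> 0 \<and> v \<noteq> 0 \<and>
     (if CARD('f) = 2 then (u, v) \<in> r \<and> (u + v, u) \<in> r \<or> (u, v) \<notin> r \<and> (u + v, v) \<in> r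
      else \<not> much_less smul r u v \<and> \<not> much_less smul r v u)" for r
    by (simp add: sim_rel_def)
  then show ?thesis by simp
qed

lemma pred_below [measurable]: "Measurable.pred XB (\<lambda>r. below r u v)"
  unfolding below_def by measurable

lemma pred_at_level [measurable]: "Measurable.pred XB (\<lambda>r. at_level r i w)"
proof (induction i arbitrary: w)
  case 0
  show ?case unfolding at_level.simps by (intro pred_intros_logic pred_all_vector) measurable
next
  case (Suc i)
  note Suc[measurable]
  show ?case unfolding at_level.simps 
    by (intro pred_intros_logic pred_ex_vector pred_all_vector) measurable
qed

lemma N_omega_sets: "N_omega smul F \<in> sets XB"
proof -
  have 1: "Measurable.pred XB (\<lambda>r. \<exists>w. at_level r i w)" for i by (intro pred_ex_vector) measurable
  have 2: "Measurable.pred XB (\<lambda>r. \<forall>v. v = 0 \<or> (\<exists>i. at_level r i v))" by (intro pred_all_vector) measurable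
  have "Measurable.pred XB (\<lambda>r. (\<forall>i. \<exists>w. at_level r i w) \<and> (\<forall>v. v = 0 \<or> (\<exists>i. at_level r i v)))"
    using 1 2 by measurable
  moreover have "N_omega smul F = 
      {r \<in> space XB. (\<forall>i. \<exists>w. at_level r i w) \<and> (\<forall>v. v = 0 \<or> (\<exists>i. at_level r i v))}"
    using N_omega_iff_at_level by (auto simp: space_XB)
  ultimately show ?thesis by (simp add: pred_def)
qed

text \<open>
  The choice of \<open>w\<close> is immaterial because any normalised vector of level \<open>i\<close> yields the same
  coefficient. The existential quantifier over the countable space shows that the entries of \<open>phi\<close>
  depend measurably on the ordering.
\<close>

lemma phi_entry_iff:
  assumes r: "r \<in> N_omega smul F"
  shows "phi smul b r j i = a \<longleftrightarrow> (\<exists>w. at_level r i w \<and> normalised r w \<and>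
    (\<forall>d. d \<noteq> a \<longrightarrow> (b j - smul a w, b j - smul d w) \<in> r))"
proof -
  obtain l where l: "r \<in> X" "level_fun r l" using r by (auto simp: N_omega_iff_level_fun)
  let ?c = "\<lambda>i v. phi_ord smul r v i"
  note c = lex_rep_phi_ord[OF l]
  have "(\<forall>d. d \<noteq> a \<longrightarrow> (b j - smul a w, b j - smul d w) \<in> r) \<longleftrightarrow> phi smul b r j i = a"
    if w: "at_level r i w" "normalised r w" for w
  proof -
    have wi: "w \<noteq> 0" "l w = i" using w at_level_iff_level_fun[OF l(2)] by auto
    then have lead: "lead ?c w = i" using c(2) by simp
    then have "?c i w = 1" using normalised_iff[OF c(1) UNIV_I wi(1)] w(2) by (simp add: normalised_def)
    then show ?thesis 
      using coefficient_iff[OF c(1) UNIV_I wi(1) _ UNIV_I, where a=a and v="b j"] lead by (auto simp: phi_def)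
  qed
  moreover have "\<exists>w. at_level r i w \<and> normalised r w"
    using class_rep_props[OF l, of i] at_level_iff_level_fun[OF l(2)] by blast
  ultimately show ?thesis by blast
qed

lemma measurable_phi:
  assumes "sets N = sets XB"
  shows "phi smul b \<in> restrict_space N (N_omega smul F) \<rightarrow>\<^sub>M sigma_prod"
proof (intro measurable_sigma_prodI measurable_count_space_finite)
  fix j i and a :: 'f
  let ?R = "restrict_space N (N_omega smul F)"
  have N: "N_omega smul F \<in> sets N" using N_omega_sets assms by simp
  have "Measurable.pred XB (\<lambda>r. \<exists>w. at_level r i w \<and> normalised r w \<and>
    (\<forall>d. d \<noteq> a \<longrightarrow> (b j - smul a w, b j - smul d w) \<in> r))"
    unfolding normalised_def by (intro pred_ex_vector) measurable
  then have S: "{r \<in> X. \<exists>w. at_level r i w \<and> normalised r w \<and>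
    (\<forall>d. d \<noteq> a \<longrightarrow> (b j - smul a w, b j - smul d w) \<in> r)} \<in> sets N"
    unfolding pred_def assms space_XB .
  have "N_omega smul F \<subseteq> X" by (auto simp: N_omega_iff_level_fun)
  then have "{r \<in> space ?R. phi smul b r j i = a} = N_omega smul F \<inter> {r \<in> X. \<exists>w. at_level r i w \<and> normalised r w \<and>
    (\<forall>d. d \<noteq> a \<longrightarrow> (b j - smul a w, b j - smul d w) \<in> r)}"
    unfolding space_restrict_space2[OF N] using phi_entry_iff by blast
  then show "{r \<in> space ?R. phi smul b r j i = a} \<in> sets ?R"
    using S by (simp add: sets_restrict_space)
qed

section \<open>Almost every matrix is regular\<close>

lemma measurable_extend [measurable]: "(\<lambda>M. extend M i v) \<in> sigma_prod \<rightarrow>\<^sub>M count_space UNIV"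
proof -
  have "(\<lambda>M. \<Sum>j\<in>J. coeffs v j * M j i) \<in> sigma_prod \<rightarrow>\<^sub>M count_space UNIV" if "finite J" for J
    using that
  proof (induction J)
    case (insert j J)
    then show ?case
      using measurable_count_space_binary[OF measurable_entry[of j i] insert.IH, of "\<lambda>p q. coeffs v j * p + q"]
      by simp
  qed simp
  then show ?thesis unfolding extend_def using finite_coeffs by simp
qed

lemma regular_sets: "regular \<in> sets sigma_prod"
proof -
  have "Measurable.pred sigma_prod (\<lambda>M. \<forall>v. v \<noteq> 0 \<longrightarrow> (\<exists>i. extend M i v \<noteq> 0))"
    by (intro pred_all_vector) measurable
  moreover have "Measurable.pred sigma_prod (\<lambda>M. \<exists>v. (\<forall>k<i. extend M k v = 0) \<and> extend M i v \<noteq> 0)" for i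
    by (intro pred_ex_vector) measurable
  ultimately have "Measurable.pred sigma_prod (\<lambda>M. (\<forall>v. v \<noteq> 0 \<longrightarrow> (\<exists>i. extend M i v \<noteq> 0)) \<and>
     (\<forall>i. \<exists>v. (\<forall>k<i. extend M k v = 0) \<and> extend M i v \<noteq> 0))" by measurable
  then show ?thesis by (simp add: regular_def pred_def)
qed

lemma extend_translate: "extend (\<lambda>j i. M j i + A j i) i v = extend M i v + extend A i v"
  by (simp add: extend_def distrib_left sum.distrib)

text \<open>
  A matrix with a single nonzero entry, in a row where \<open>v\<close> has a nonzero coordinate, translates
  the event in question to the event that the values at \<open>v\<close> form a given unit sequence. These are
  infinitely many disjoint events of the same probability.
\<close>

lemma extend_null:
  assumes "v \<noteq> 0"
  shows "emeasure sigma_prod {M. \<forall>i. extend M i v = 0} = 0"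
proof -
  interpret prob_space "sigma_prod :: (nat \<Rightarrow> nat \<Rightarrow> 'f) measure" by (rule prob_space_sigma_prod)
  obtain k where k: "coeffs v k \<noteq> 0"
    using coeffs_expand[of "{}" v] assms by auto
  define Z where "Z n = {M. \<forall>i. extend M i v = (if i = n then 1 else 0)}" for n :: nat
  have Z0[measurable]: "{M. \<forall>i. extend M i v = 0} \<in> events" and Zn: "Z n \<in> events" for n
  proof -
    have "{M \<in> space sigma_prod. \<forall>i. extend M i v = a i} \<in> events" for a by measurable
    then show "{M. \<forall>i. extend M i v = 0} \<in> events" "Z n \<in> events" by (simp_all add: Z_def)
  qed
  have "prob (Z n) = prob {M. \<forall>i. extend M i v = 0}" for n
  proof -
    define A where "A j i = (if j = k \<and> i = n then 1 / coeffs v k else 0)" for j i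
    have A: "extend A i v = (if i = n then 1 else 0)" for i
      using k finite_coeffs[of v] by (simp add: extend_def A_def mult_delta_right)
    have "(\<lambda>M j i. M j i + A j i) -` Z n = {M. \<forall>i. extend M i v = 0}"
      by (auto simp: Z_def extend_translate A)
    then have "emeasure (distr sigma_prod sigma_prod (\<lambda>M j i. M j i + A j i)) (Z n) = 
        emeasure sigma_prod {M. \<forall>i. extend M i v = 0}"
      using Zn by (subst emeasure_distr) (simp_all add: measurable_translate)
    then show ?thesis by (simp add: translate_sigma_prod measure_def)
  qed
  then have "prob {M. \<forall>i. extend M i v = 0} = 0"
  proof (rule infinitely_many_equal_disjoint_null[rotated 2])
    have "False" if "m \<noteq> n" "M \<in> Z m" "M \<in> Z n" for m n M
      using that by (auto simp: Z_def split: if_splits)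
    then show "disjoint_family Z" by (auto simp: disjoint_family_on_def)
  qed (use Zn in auto)
  then show ?thesis by (simp add: emeasure_eq_measure)
qed

text \<open>
  The rows are independent, and each avoids the pattern with the same probability \<open>1 - p < 1\<close>.
\<close>

lemma row_pattern_missing_null:
  "emeasure sigma_prod {M :: nat \<Rightarrow> nat \<Rightarrow> 'f. \<forall>j. \<not> ((\<forall>k<i. M j k = 0) \<and> M j i = 1)} = 0"
proof -
  interpret U: prob_space "uniform_count_measure (UNIV :: 'f set)" by (rule prob_space_uniform)
  interpret R: product_prob_space "\<lambda>_::nat. uniform_count_measure (UNIV :: 'f set)" UNIV
    by (intro product_prob_spaceI prob_space_uniform)
  interpret S: product_prob_space "\<lambda>_::nat. uniform_sequence :: (nat \<Rightarrow> 'f) measure" UNIV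
    by (intro product_prob_spaceI prob_space_uniform_sequence)
  interpret M: prob_space "sigma_prod :: (nat \<Rightarrow> nat \<Rightarrow> 'f) measure" by (rule prob_space_sigma_prod)
  define C :: "(nat \<Rightarrow> 'f) set" where "C = {x. (\<forall>k<i. x k = 0) \<and> x i = 1}"
  define p where "p = measure uniform_sequence C"
  have C_eq: "C = {x \<in> space uniform_sequence. \<forall>k\<in>{..i}. x k \<in> {if k = i then 1 else 0}}"
    by (auto simp: C_def)
  have entry: "{x \<in> space uniform_sequence. x k \<in> A} \<in> sets uniform_sequence" for k and A :: "'f set"
    using measurable_sets[OF measurable_component_singleton[of k UNIV "\<lambda>_. uniform_count_measure (UNIV :: 'f set)"], of A]
    by (simp add: sets_uniform_count_measure vimage_def)
  have C: "C \<in> sets uniform_sequence" unfolding C_eq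
    by (rule sets.sets_Collect_finite_All'[OF entry]) auto
  have "emeasure uniform_sequence C = (\<Prod>k\<in>{..i}. emeasure (uniform_count_measure UNIV) {if k = i then 1 else 0 :: 'f})"
    unfolding C_eq by (rule R.emeasure_PiM_Collect) (auto simp: sets_uniform_count_measure)
  also have "\<dots> \<noteq> 0" 
    by (simp add: emeasure_uniform_count_measure)
  finally have "p > 0" by (simp add: p_def R.emeasure_eq_measure measure_nonneg zero_less_measure_iff)
  have "p \<le> 1" by (simp add: p_def)
  let ?D = "{M :: nat \<Rightarrow> nat \<Rightarrow> 'f. \<forall>j. M j \<notin> C}"
  have bound: "emeasure sigma_prod ?D \<le> ennreal ((1 - p) ^ n)" for n
  proof -
    let ?B = "{M \<in> space sigma_prod. \<forall>j\<in>{..<n}. M j \<in> - C}"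
    have nC: "- C \<in> sets uniform_sequence" using sets.compl_sets[OF C] by (simp add: Compl_eq_Diff_UNIV)
    have "emeasure sigma_prod ?B = (\<Prod>j\<in>{..<n}. emeasure uniform_sequence (- C))"
      unfolding sigma_prod_def using nC by (intro S.emeasure_PiM_Collect) auto
    also have "emeasure uniform_sequence (- C) = ennreal (1 - p)"
      using R.prob_compl[OF C] by (simp add: R.emeasure_eq_measure p_def Compl_eq_Diff_UNIV)
    also have "(\<Prod>j\<in>{..<n}. ennreal (1 - p)) = ennreal ((1 - p) ^ n)"
      using \<open>p \<le> 1\<close> by (simp add: ennreal_power)
    finally have e: "emeasure sigma_prod ?B = ennreal ((1 - p) ^ n)" .
    have "?B \<in> sets sigma_prod"
      unfolding sigma_prod_def using nC by measurable
    then have "emeasure sigma_prod ?D \<le> emeasure sigma_prod ?B" by (intro emeasure_mono) auto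
    then show ?thesis using e by simp
  qed
  have "(\<lambda>n. (1 - p) ^ n) \<longlonglongrightarrow> 0" using \<open>p > 0\<close> \<open>p \<le> 1\<close> by (intro LIMSEQ_power_zero) auto
  then have "(\<lambda>n. ennreal ((1 - p) ^ n)) \<longlonglongrightarrow> 0" using tendsto_ennrealI by fastforce
  then have "emeasure sigma_prod ?D \<le> 0" using bound by (intro LIMSEQ_le_const) auto
  then show ?thesis by (simp add: C_def)
qed

text \<open>
  A matrix outside countably many null sets is regular. For each of the countably many \<open>v \<noteq> 0\<close>, the
  set where all forms vanish at \<open>v\<close> is excluded; for each \<open>i\<close>, the set where no row begins with \<open>i\<close>
  zeros followed by a 1. If row \<open>j\<close> begins like this, then \<open>b j\<close> has lead \<open>i\<close>.
\<close>

lemma emeasure_regular: "emeasure sigma_prod regular = 1"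
proof -
  interpret prob_space "sigma_prod :: (nat \<Rightarrow> nat \<Rightarrow> 'f) measure" by (rule prob_space_sigma_prod)
  have 1: "{M. \<forall>i. extend M i v = 0} \<in> null_sets sigma_prod" if "v \<noteq> 0" for v
  proof -
    have "{M \<in> space sigma_prod. \<forall>i. extend M i v = 0} \<in> events" by measurable
    then show ?thesis using extend_null[OF that] by (auto simp: null_sets_def)
  qed
  have 2: "{M :: nat \<Rightarrow> nat \<Rightarrow> 'f. \<forall>j. \<not> ((\<forall>k<i. M j k = 0) \<and> M j i = 1)} \<in> null_sets sigma_prod" for i
  proof -
    have "{M \<in> space sigma_prod. \<forall>j. \<not> ((\<forall>k<i. M j k = 0) \<and> M j i = (1 :: 'f))} \<in> events" by measurable
    then show ?thesis using row_pattern_missing_null[of i] by (auto simp: null_sets_def)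
  qed
  let ?B = "(\<Union>v\<in>UNIV - {0}. {M. \<forall>i. extend M i v = 0}) \<union> 
    (\<Union>i. {M :: nat \<Rightarrow> nat \<Rightarrow> 'f. \<forall>j. \<not> ((\<forall>k<i. M j k = 0) \<and> M j i = 1)})"
  have "?B \<in> null_sets sigma_prod"
    using countable_space 1 2 by (intro null_sets.Un null_sets_UN') (auto intro: countable_subset)
  moreover have "- regular \<subseteq> ?B"
  proof
    fix M assume M: "M \<in> - regular"
    show "M \<in> ?B"
    proof (rule ccontr)
      assume nB: "M \<notin> ?B"
      have "\<exists>v. (\<forall>k<i. extend M k v = 0) \<and> extend M i v \<noteq> 0" for i
      proof -
        obtain j where "(\<forall>k<i. M j k = 0) \<and> M j i = 1" using nB by blast
        then show ?thesis by (intro exI[of _ "b j"]) simp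
      qed
      moreover have "\<exists>i. extend M i v \<noteq> 0" if "v \<noteq> 0" for v using nB that by blast
      ultimately have "M \<in> regular" unfolding regular_def by blast
      then show False using M by simp
    qed
  qed
  moreover have "- regular \<in> sets sigma_prod" using sets.compl_sets[OF regular_sets] by (simp add: Compl_eq_Diff_UNIV)
  ultimately have "- regular \<in> null_sets sigma_prod" using null_sets_subset by blast
  then have "AE M in sigma_prod. M \<in> regular" by (intro AE_I'[of "- regular"]) auto
  then show ?thesis using regular_sets by (simp add: emeasure_eq_1_AE)
qed

lemma measurable_twist: "twist g \<in> sigma_prod \<rightarrow>\<^sub>M sigma_prod"
  by (rule measurable_sigma_prodI) (simp add: twist_def)

text \<open>
  Since \<open>twist g\<close> is additive and surjective, every translation of the image lifts to a translation
  of the source, so the image measure is translation-invariant.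
\<close>

lemma twist_sigma_prod:
  assumes g: "g \<in> Aut smul"
  shows "distr sigma_prod sigma_prod (twist g) = sigma_prod"
proof (rule translation_invariant_unique)
  let ?P = "sigma_prod :: (nat \<Rightarrow> nat \<Rightarrow> 'f) measure"
  show "prob_space (distr ?P ?P (twist g))"
    by (rule prob_space.prob_space_distr[OF prob_space_sigma_prod measurable_twist])
  fix A :: "nat \<Rightarrow> nat \<Rightarrow> 'f"
  let ?t = "\<lambda>A M j i. M j i + A j i :: 'f"
  define A' where "A' = twist (inv g) A"
  have "?t A (twist g M) = twist g (?t A' M)" for M
  proof -
    have "A = twist g A'" using twist_inv[OF g] by (simp add: A'_def)
    then show ?thesis by (auto simp: twist_def extend_translate fun_eq_iff)
  qed
  then have eq: "?t A \<circ> twist g = twist g \<circ> ?t A'" by (simp add: comp_def)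
  have "distr (distr ?P ?P (twist g)) ?P (?t A) = distr ?P ?P (?t A \<circ> twist g)"
    by (rule distr_distr[OF measurable_translate measurable_twist])
  also have "\<dots> = distr (distr ?P ?P (?t A')) ?P (twist g)"
    unfolding eq by (rule distr_distr[OF measurable_twist measurable_translate, symmetric])
  also have "\<dots> = distr ?P ?P (twist g)" by (simp add: translate_sigma_prod)
  finally show "distr (distr ?P ?P (twist g)) ?P (?t A) = distr ?P ?P (twist g)" .
qed simp

section \<open>Invariant measures on orderings\<close>

lemma measurable_lex_order: "lex_order \<in> restrict_space sigma_prod regular \<rightarrow>\<^sub>M XB"
proof (rule measurable_XBI)
  show "lex_order \<in> space (restrict_space sigma_prod regular) \<rightarrow> X"
    using lex_order_in_N_omega by (auto simp: space_restrict_space N_omega_iff_level_fun)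
  fix u v
  have eq: "Measurable.pred sigma_prod (\<lambda>M. extend M i u = extend M i v)" for i
    using measurable_count_space_binary[OF measurable_extend measurable_extend, of "(=)" i u i v] by simp
  have ls: "Measurable.pred sigma_prod (\<lambda>M. (extend M i u, extend M i v) \<in> F)" for i
    using measurable_count_space_binary[OF measurable_extend measurable_extend, of "\<lambda>p q. (p, q) \<in> F" i u i v] by simp
  have "Measurable.pred sigma_prod (\<lambda>M. (u, v) \<in> lex_order M)"
    unfolding lex_order_def lex_less_def using eq ls by simp
  then have "Measurable.pred (restrict_space sigma_prod regular) (\<lambda>M. (u, v) \<in> lex_order M)"
    by (rule measurable_restrict_space1)
  then show "{M \<in> space (restrict_space sigma_prod regular). (u, v) \<in> lex_order M} \<in> 
    sets (restrict_space sigma_prod regular)" by (simp add: pred_def)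
qed

definition lex_measure :: "'v rel measure" where
  "lex_measure = distr (restrict_space sigma_prod regular) XB lex_order"

lemma sets_lex_measure: "sets lex_measure = sets XB"
  by (simp add: lex_measure_def)

lemma regular_vimage_sets:
  assumes "A \<in> sets XB" shows "{M \<in> regular. lex_order M \<in> A} \<in> sets sigma_prod"
proof -
  have "lex_order -` A \<inter> space (restrict_space sigma_prod regular) \<in> sets (restrict_space sigma_prod regular)"
    using measurable_lex_order assms by (rule measurable_sets)
  moreover have "lex_order -` A \<inter> space (restrict_space sigma_prod regular) = {M \<in> regular. lex_order M \<in> A}"
    by (auto simp: space_restrict_space)
  ultimately show ?thesis using regular_sets by (simp add: sets_restrict_space_iff)
qed

lemma emeasure_lex_measure:
  assumes "A \<in> sets XB"
  shows "emeasure lex_measure A = emeasure sigma_prod {M \<in> regular. lex_order M \<in> A}"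
proof -
  have "lex_order -` A \<inter> space (restrict_space sigma_prod regular) = {M \<in> regular. lex_order M \<in> A}"
    by (auto simp: space_restrict_space)
  then show ?thesis unfolding lex_measure_def
    using assms measurable_lex_order regular_sets 
    by (simp add: emeasure_distr emeasure_restrict_space Collect_restrict)
qed

lemma prob_space_lex_measure: "prob_space lex_measure"
  unfolding lex_measure_def
  by (intro prob_space.prob_space_distr prob_space_restrict_space regular_sets emeasure_regular measurable_lex_order)

lemma act_image:
  assumes g: "g \<in> Aut smul" and A: "A \<subseteq> X"
  shows "act g ` A = {r \<in> X. act (inv g) r \<in> A}"
proof (intro equalityI subsetI)
  fix r assume "r \<in> act g ` A"
  then show "r \<in> {r \<in> X. act (inv g) r \<in> A}" using act_in_X_space[OF g] A act_inv(2)[OF g] by auto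
next
  fix r assume "r \<in> {r \<in> X. act (inv g) r \<in> A}"
  then show "r \<in> act g ` A" using act_inv(1)[OF g, of r] by (auto intro: image_eqI[of _ _ "act (inv g) r"])
qed

lemma measurable_act:
  assumes g: "g \<in> Aut smul"
  shows "act g \<in> XB \<rightarrow>\<^sub>M XB"
proof (rule measurable_XBI)
  show "act g \<in> space XB \<rightarrow> X" using act_in_X_space[OF g] by (auto simp: space_XB)
  show "{r \<in> space XB. (u, v) \<in> act g r} \<in> sets XB" for u v
    unfolding act_iff[OF g] by measurable
qed

text \<open>
  Acting by \<open>g\<close> on the pulled back ordering corresponds to twisting the matrix, which preserves
  the uniform measure.
\<close>

lemma invariant_lex_measure: "invariant_borel_prob smul F lex_measure"
  unfolding invariant_borel_prob_def
proof (intro conjI ballI prob_space_lex_measure sets_lex_measure)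
  fix g A assume g: "g \<in> Aut smul" and "A \<in> sets lex_measure"
  then have A: "A \<in> sets XB" using sets_lex_measure by simp
  then have AX: "A \<subseteq> X" using sets.sets_into_space space_XB by blast
  have "act (inv g) -` A \<inter> space XB \<in> sets XB" using measurable_act[OF Aut_inv[OF g]] A by (rule measurable_sets)
  then have gA: "act g ` A \<in> sets XB" unfolding act_image[OF g AX] by (simp add: space_XB vimage_def Int_def conj_commute)
  have "{M \<in> regular. lex_order M \<in> act g ` A} = twist g -` {M \<in> regular. lex_order M \<in> A}"
  proof -
    have "lex_order M \<in> act g ` A \<longleftrightarrow> lex_order (twist g M) \<in> A" for M
    proof
      assume "lex_order M \<in> act g ` A"
      then obtain r where "r \<in> A" "lex_order M = act g r" by blast
      then have "act (inv g) (act g (lex_order (twist g M))) = act (inv g) (act g r)" 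
        using lex_order_twist[OF g, of M] by simp
      then show "lex_order (twist g M) \<in> A" using act_inv(2)[OF g] \<open>r \<in> A\<close> by simp
    next
      assume "lex_order (twist g M) \<in> A"
      then show "lex_order M \<in> act g ` A" using lex_order_twist[OF g, of M] by (metis imageI)
    qed
    then show ?thesis using regular_twist[OF g] by auto
  qed
  moreover have "emeasure (distr sigma_prod sigma_prod (twist g)) {M \<in> regular. lex_order M \<in> A} =
      emeasure sigma_prod (twist g -` {M \<in> regular. lex_order M \<in> A})"
    using measurable_twist regular_vimage_sets[OF A] by (subst emeasure_distr) simp_all
  ultimately show "emeasure lex_measure (act g ` A) = emeasure lex_measure A"
    using emeasure_lex_measure[OF A] emeasure_lex_measure[OF gA] twist_sigma_prod[OF g] by simp
qed

text \<open>
  An automorphism that carries \<open>r\<close> to \<open>r'\<close> on \<open>flag n\<close> and preserves \<open>flag n\<close> maps the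
  orderings that agree there with \<open>r\<close> onto those that agree with \<open>r'\<close>.
\<close>

lemma act_cell:
  assumes "r \<in> X" "r' \<in> X"
  shows "\<exists>g\<in>Aut smul. act g ` cell n r = cell n r'"
proof -
  obtain g where g: "g \<in> Aut smul" and gf: "\<And>u. u \<in> flag n \<Longrightarrow> inv g u \<in> flag n"
    and gr: "\<And>u v. u \<in> flag n \<Longrightarrow> v \<in> flag n \<Longrightarrow> (inv g u, inv g v) \<in> r \<longleftrightarrow> (u, v) \<in> r'"
    using transitive_on_flag[OF assms, of n] by blast
  have bij: "bij g" using g by (simp add: Aut_iff)
  have "inv g ` flag n = flag n"
    using finite_flag gf inj_on_subset[OF bij_is_inj[OF bij_imp_bij_inv[OF bij]] subset_UNIV]
    by (intro endo_inj_surj) auto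
  then have surj: "\<exists>u'\<in>flag n. u = inv g u'" if "u \<in> flag n" for u using that by blast
  have "\<rho> \<in> act g ` cell n r \<longleftrightarrow> \<rho> \<in> cell n r'" for \<rho>
  proof -
    have "cell n r \<subseteq> X" by (auto simp: in_cell_iff)
    then have "\<rho> \<in> act g ` cell n r \<longleftrightarrow> \<rho> \<in> X \<and> act (inv g) \<rho> \<in> cell n r" by (simp add: act_image[OF g])
    also have "\<dots> \<longleftrightarrow> \<rho> \<in> X \<and> (\<forall>u\<in>flag n. \<forall>v\<in>flag n. (u, v) \<in> act (inv g) \<rho> \<longleftrightarrow> (u, v) \<in> r)"
      using act_in_X_space[OF Aut_inv[OF g]] by (auto simp: in_cell_iff)
    also have "\<dots> \<longleftrightarrow> \<rho> \<in> X \<and> (\<forall>u\<in>inv g ` flag n. \<forall>v\<in>inv g ` flag n. (u, v) \<in> act (inv g) \<rho> \<longleftrightarrow> (u, v) \<in> r)"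
      unfolding \<open>inv g ` flag n = flag n\<close> ..
    also have "\<dots> \<longleftrightarrow> \<rho> \<in> X \<and> (\<forall>u\<in>flag n. \<forall>v\<in>flag n. (u, v) \<in> \<rho> \<longleftrightarrow> (u, v) \<in> r')"
      using gr bij by (simp add: act_iff[OF Aut_inv[OF g]] inv_inv_eq bij_is_surj surj_f_inv_f)
    finally show ?thesis by (simp add: in_cell_iff)
  qed
  then show ?thesis using g by blast
qed

lemma invariant_borel_prob_unique:
  assumes \<mu>: "invariant_borel_prob smul F \<mu>" and \<nu>: "invariant_borel_prob smul F \<nu>"
  shows "\<mu> = \<nu>"
proof (rule prob_eqI_nested_partitions[where \<A>="\<lambda>n. cell n ` X" and \<Omega>=X])
  show "prob_space \<mu>" "prob_space \<nu>" "sets \<mu> = sigma_sets X (\<Union>n. cell n ` X)" "sets \<nu> = sigma_sets X (\<Union>n. cell n ` X)"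
    using \<mu> \<nu> by (auto simp: invariant_borel_prob_def sets_XB_cells)
  show "\<Union> (cell n ` X) = X" for n by (auto simp: in_cell_iff)
  have eq: "emeasure \<mu> A = emeasure \<mu> B" if \<mu>: "invariant_borel_prob smul F \<mu>" 
    and AB: "A \<in> cell n ` X" "B \<in> cell n ` X" for n A B and \<mu> :: "'v rel measure"
  proof -
    obtain r r' where r: "r \<in> X" "r' \<in> X" "A = cell n r" "B = cell n r'" using AB by blast
    obtain g where "g \<in> Aut smul" "act g ` A = B" using act_cell[OF r(1,2)] r(3,4) by blast
    moreover have "A \<in> sets \<mu>" using cell_sets r \<mu> by (auto simp: invariant_borel_prob_def)
    ultimately show ?thesis using \<mu> unfolding invariant_borel_prob_def by metis
  qed
  show "emeasure \<mu> A = emeasure \<mu> B" "emeasure \<nu> A = emeasure \<nu> B" if "A \<in> cell n ` X" "B \<in> cell n ` X" for n A B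
    using eq[OF \<mu> that] eq[OF \<nu> that] by auto
  show "B \<subseteq> A \<or> A \<inter> B = {}" if mn: "m \<le> n" "A \<in> cell m ` X" "B \<in> cell n ` X" for m n A B
  proof -
    obtain r r' where r: "A = cell m r" "B = cell n r'" using mn by blast
    have "B \<subseteq> A" if ne: "A \<inter> B \<noteq> {}"
    proof -
      obtain \<rho> where "\<rho> \<in> A" "\<rho> \<in> B" using ne by blast
      then have "cell m \<rho> = A" "cell n \<rho> = B" by (auto simp: r in_cell_iff)
      then show ?thesis using cell_mono[OF mn(1)] by blast
    qed
    then show ?thesis by blast
  qed
qed (fact finite_cells)


section \<open>The isomorphism\<close>

text \<open>
  The uniqueness of the invariant measure identifies \<open>\<mu>\<close> with the image of the uniform measure
  under \<open>lex_order\<close>. Everything else follows because \<open>phi\<close> and \<open>lex_order\<close> are mutually inverse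
  measurable bijections between \<open>N_omega\<close> and the regular matrices, which have full measure.
\<close>

theorem phi_isomorphism:
  assumes \<mu>: "invariant_borel_prob smul F \<mu>"
  shows "phi smul b \<in> restrict_space \<mu> (N_omega smul F) \<rightarrow>\<^sub>M sigma_prod"
    and "inj_on (phi smul b) (N_omega smul F)"
    and "emeasure sigma_prod (phi smul b ` N_omega smul F) = 1"
    and "distr (restrict_space \<mu> (N_omega smul F)) sigma_prod (phi smul b) = sigma_prod"
    and "mod_zero_isomorphism \<mu> sigma_prod (N_omega smul F) (phi smul b)"
proof -
  let ?N = "N_omega smul F" and ?\<phi> = "phi smul b"
  let ?\<sigma> = "sigma_prod :: (nat \<Rightarrow> nat \<Rightarrow> 'f) measure"
  let ?R = "restrict_space \<mu> ?N" and ?S = "restrict_space ?\<sigma> regular"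
  interpret \<mu>: prob_space \<mu> using \<mu> by (simp add: invariant_borel_prob_def)
  interpret \<sigma>: prob_space ?\<sigma> by (rule prob_space_sigma_prod)
  have eq: "\<mu> = lex_measure" using invariant_borel_prob_unique[OF \<mu> invariant_lex_measure] .
  have sets: "sets \<mu> = sets XB" using \<mu> by (simp add: invariant_borel_prob_def)
  have space: "space \<mu> = X" using sets_eq_imp_space_eq[OF sets] space_XB by simp
  have N: "?N \<in> sets \<mu>" using N_omega_sets sets by simp
  show meas: "?\<phi> \<in> ?R \<rightarrow>\<^sub>M ?\<sigma>" by (rule measurable_phi[OF sets])
  show inj: "inj_on ?\<phi> ?N" using bij_phi by (rule bij_betw_imp_inj_on)
  have img: "?\<phi> ` ?N = regular" using bij_phi by (rule bij_betw_imp_surj_on)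
  show "emeasure ?\<sigma> (?\<phi> ` ?N) = 1" unfolding img by (rule emeasure_regular)
  have em: "emeasure \<mu> A = emeasure ?\<sigma> {M \<in> regular. lex_order M \<in> A}" if "A \<in> sets \<mu>" for A
    using emeasure_lex_measure that sets unfolding eq by simp
  have AE_regular: "AE M in ?\<sigma>. M \<in> regular"
    using \<sigma>.prob_eq_1[OF regular_sets] emeasure_regular by (simp add: measure_def)
  have push: "emeasure ?R (?\<phi> -` C \<inter> space ?R) = emeasure ?\<sigma> (regular \<inter> C)" if C: "C \<in> sets ?\<sigma>" for C
  proof -
    have sp: "space ?R = ?N" using N by simp
    have "?\<phi> -` C \<inter> space ?R \<in> sets ?R" using meas C by (rule measurable_sets)
    then have sub: "?\<phi> -` C \<inter> ?N \<in> sets \<mu>" using N unfolding sp by (simp add: sets_restrict_space_iff)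
    have "emeasure ?R (?\<phi> -` C \<inter> space ?R) = emeasure \<mu> (?\<phi> -` C \<inter> ?N)"
      unfolding sp using N by (intro emeasure_restrict_space) auto
    also have "\<dots> = emeasure ?\<sigma> {M \<in> regular. lex_order M \<in> ?\<phi> -` C \<inter> ?N}" by (rule em[OF sub])
    also have "{M \<in> regular. lex_order M \<in> ?\<phi> -` C \<inter> ?N} = regular \<inter> C"
      using phi_lex_order lex_order_in_N_omega by auto
    finally show ?thesis .
  qed
  have full: "emeasure ?\<sigma> (regular \<inter> C) = emeasure ?\<sigma> C" if C: "C \<in> sets ?\<sigma>" for C
  proof (rule emeasure_eq_AE)
    show "AE M in ?\<sigma>. M \<in> regular \<inter> C \<longleftrightarrow> M \<in> C"
      using AE_regular by (rule eventually_mono) simp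
  qed (use C regular_sets in auto)
  show "distr ?R ?\<sigma> ?\<phi> = ?\<sigma>"
  proof (rule measure_eqI)
    fix C assume "C \<in> sets (distr ?R ?\<sigma> ?\<phi>)"
    then have C: "C \<in> sets ?\<sigma>" by simp
    show "emeasure (distr ?R ?\<sigma> ?\<phi>) C = emeasure ?\<sigma> C"
      using emeasure_distr[OF meas C] push[OF C] full[OF C] by simp
  qed simp
  have measR: "?\<phi> \<in> ?R \<rightarrow>\<^sub>M ?S"
    using meas N phi_regular(1) by (intro measurable_restrict_space2) auto
  have inv: "the_inv_into ?N ?\<phi> M = lex_order M" if "M \<in> regular" for M
    using the_inv_into_f_eq[OF inj phi_lex_order[OF that] lex_order_in_N_omega[OF that]] .
  have "lex_order \<in> ?S \<rightarrow>\<^sub>M \<mu>" using measurable_lex_order sets by (simp cong: measurable_cong_sets)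
  then have "lex_order \<in> ?S \<rightarrow>\<^sub>M ?R"
    using lex_order_in_N_omega regular_sets by (intro measurable_restrict_space2) auto
  then have measI: "the_inv_into ?N ?\<phi> \<in> ?S \<rightarrow>\<^sub>M ?R"
    using inv regular_sets by (subst measurable_cong[of _ _ lex_order]) auto
  have "distr ?R ?S ?\<phi> = ?S"
  proof (rule measure_eqI)
    fix C assume "C \<in> sets (distr ?R ?S ?\<phi>)"
    then have CS: "C \<in> sets ?S" by simp
    then have C: "C \<subseteq> regular" "C \<in> sets ?\<sigma>" using regular_sets by (auto simp: sets_restrict_space_iff)
    then have "regular \<inter> C = C" by blast
    then show "emeasure (distr ?R ?S ?\<phi>) C = emeasure ?S C"
      using emeasure_distr[OF measR CS] push[OF C(2)] C regular_sets by (simp add: emeasure_restrict_space)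
  qed simp
  moreover have "space \<mu> - ?N \<in> null_sets \<mu>"
  proof -
    have "{M \<in> regular. lex_order M \<in> ?N} = regular" using lex_order_in_N_omega by auto
    then have "emeasure \<mu> ?N = 1" using em[OF N] emeasure_regular by simp
    then have "AE r in \<mu>. r \<in> ?N" using \<mu>.prob_eq_1[OF N] by (simp add: measure_def)
    then have "AE r in \<mu>. r \<notin> space \<mu> - ?N" by (rule eventually_mono) simp
    then show ?thesis using N AE_iff_null_sets[of "space \<mu> - ?N" \<mu>] by blast
  qed
  moreover have "space ?\<sigma> - regular \<in> null_sets ?\<sigma>"
  proof -
    have "AE M in ?\<sigma>. M \<notin> space ?\<sigma> - regular" using AE_regular by (rule eventually_mono) simp
    then show ?thesis using regular_sets AE_iff_null_sets[of "space ?\<sigma> - regular" ?\<sigma>] by blast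
  qed
  ultimately show "mod_zero_isomorphism \<mu> ?\<sigma> ?N ?\<phi>"
    unfolding mod_zero_isomorphism_def
    using N regular_sets bij_phi measR measI by (intro exI[of _ ?N] exI[of _ regular]) simp
qed

end

theorem theorem8p3:
  fixes smul :: "'f::{field,finite} \<Rightarrow> 'v::ab_group_add \<Rightarrow> 'v"
    and F :: "'f rel"
    and b :: "nat \<Rightarrow> 'v"
    and \<mu> :: "'v rel measure"
  assumes "vector_space smul"
    and "field_ordering F"
    and "inj b"
    and "\<not> module.dependent smul (range b)"
    and "module.span smul (range b) = UNIV"
    and "invariant_borel_prob smul F \<mu>"
  shows "phi smul b \<in> restrict_space \<mu> (N_omega smul F) \<rightarrow>\<^sub>M sigma_prod \<and>
    inj_on (phi smul b) (N_omega smul F) \<and>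
    emeasure sigma_prod (phi smul b ` N_omega smul F) = 1 \<and>
    distr (restrict_space \<mu> (N_omega smul F)) sigma_prod (phi smul b) = sigma_prod \<and>
    mod_zero_isomorphism \<mu> sigma_prod (N_omega smul F) (phi smul b)"
proof -
  interpret vector_space smul by fact
  interpret ordered_basis smul F b
    using assms by unfold_locales
  show ?thesis using phi_isomorphism[OF assms(6)] by blast
qed

end
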